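(* Let $\tau>\sqrt{3+\sqrt{10}}$. Then the support of every minimizer $\rho$ of the action $S$ on the circle $S^1$ (with parameter $\tau$) is a chain $\{x_1,\ldots,x_{m_0}\}$ of length $m_0$. The minimal action is $$S_{\min}=\frac{L(0)\,\big(L(0)+L(\gamma)\big)}{(m_0-2)\,\big(L(0)+L(\gamma)\big)+2L(0)},$$ where $\gamma=\arccos(\langle x_1,x_{m_0}\rangle)\in(0,\vartheta_{\max}]$. The minimizing measure is unique up to rotations on $S^1$.
   Context: Let $S^1\subset\mathbb{R}^2$ be the unit circle and, for a parameter $\tau\ge1$, let $$D(x,y)=2\tau^2\,(1+\langle x,y\rangle)\,\big(2-\tau^2(1-\langle x,y\rangle)\big),\qquad x,y\in S^1,$$ where $\langle\cdot,\cdot\rangle$ is the Euclidean scalar product, and $L=\max(0,D)$. Since $D$ and $L$ depend only on the angle $\vartheta\in[0,\pi]$ with $\cos\vartheta=\langle x,y\rangle$, one also writes $D(\vartheta)$, $L(\vartheta)$. $\mathfrak{M}$ is the set of all normalized (total mass one) positive regular Borel measures on $S^1$; $S[\rho]=\iint L(x,y)\,d\rho(x)\,d\rho(y)$ and $S_{\min}=\inf_{\tilde\rho\in\mathfrak{M}}S[\tilde\rho]$. A minimizer is a $\rho\in\mathfrak{M}$ with $S[\rho]=S_{\min}$. Set $\vartheta_{\max}=\arccos\big(1-\tfrac{2}{\tau^2}\big)$ and $m_0=\min\{n\in\mathbb{N}: n\ge 2\pi/\vartheta_{\max}\}$. A chain of length $k$ is a sequence $x_1,\ldots,x_k\in S^1$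 of pairwise distinct points such that $\langle x_i,x_{i+1}\rangle=\cos(\vartheta_{\max})$ for all $i=1,\ldots,k-1$. *)

theory Defs
  imports "HOL-Probability.Probability"
begin

type_synonym plane = "real ^ 2"

abbreviation S1 :: "plane set" where
  "S1 \<equiv> sphere 0 1"

(* The polynomial through which D depends on c = <x,y> = cos \<theta>. *)
definition D_poly :: "real \<Rightarrow> real \<Rightarrow> real" where
  "D_poly \<tau> c = 2 * \<tau>\<^sup>2 * (1 + c) * (2 - \<tau>\<^sup>2 * (1 - c))"

definition D_fun :: "real \<Rightarrow> plane \<Rightarrow> plane \<Rightarrow> real" where
  "D_fun \<tau> x y = D_poly \<tau> (x \<bullet> y)"

definition L_fun :: "real \<Rightarrow> plane \<Rightarrow> plane \<Rightarrow> real" where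
  "L_fun \<tau> x y = max 0 (D_fun \<tau> x y)"

definition D_angle :: "real \<Rightarrow> real \<Rightarrow> real" where
  "D_angle \<tau> \<theta> = D_poly \<tau> (cos \<theta>)"

definition L_angle :: "real \<Rightarrow> real \<Rightarrow> real" where
  "L_angle \<tau> \<theta> = max 0 (D_angle \<tau> \<theta>)"

definition regular_on_circle :: "plane measure \<Rightarrow> bool" where
  "regular_on_circle \<rho> \<longleftrightarrow> (\<forall>A\<in>sets \<rho>.
     emeasure \<rho> A = (SUP K\<in>{K. K \<subseteq> A \<and> compact K}. emeasure \<rho> K) \<and>
     emeasure \<rho> A = (INF U\<in>{U. A \<subseteq> U \<and> openin (top_of_set S1) U}. emeasure \<rho> U))"

(* The measures live on the circle itself: the carrier is S1, with its Borel
   sigma-algebra as a subspace of the plane. *)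
definition normalized_measures :: "plane measure set" where
  "normalized_measures =
     {\<rho>. sets \<rho> = sets (restrict_space borel S1) \<and> prob_space \<rho> \<and> regular_on_circle \<rho>}"

definition action :: "real \<Rightarrow> plane measure \<Rightarrow> real" where
  "action \<tau> \<rho> = (\<integral>x. (\<integral>y. L_fun \<tau> x y \<partial>\<rho>) \<partial>\<rho>)"

definition min_action :: "real \<Rightarrow> real" where
  "min_action \<tau> = (INF \<rho>\<in>normalized_measures. action \<tau> \<rho>)"

definition minimizer :: "real \<Rightarrow> plane measure \<Rightarrow> bool" where
  "minimizer \<tau> \<rho> \<longleftrightarrow> \<rho> \<in> normalized_measures \<and> action \<tau> \<rho> = min_action \<tau>"

(* The complement in S1 of the union of all relatively open null sets. *)
definition measure_support :: "plane measure \<Rightarrow> plane set" where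
  "measure_support \<rho> = S1 - \<Union>{U. openin (top_of_set S1) U \<and> emeasure \<rho> U = 0}"

definition theta_max :: "real \<Rightarrow> real" where
  "theta_max \<tau> = arccos (1 - 2 / \<tau>\<^sup>2)"

definition m0 :: "real \<Rightarrow> nat" where
  "m0 \<tau> = (LEAST n. real n \<ge> 2 * pi / theta_max \<tau>)"

(* A chain is encoded as the list of its points; its length in the sense of
   chains is the length of the list. *)
definition is_chain :: "real \<Rightarrow> plane list \<Rightarrow> bool" where
  "is_chain \<tau> xs \<longleftrightarrow> set xs \<subseteq> S1 \<and> distinct xs \<and>
     (\<forall>i. Suc i < length xs \<longrightarrow> xs ! i \<bullet> xs ! Suc i = cos (theta_max \<tau>))"

definition rotate_measure :: "real ^ 2 ^ 2 \<Rightarrow> plane measure \<Rightarrow> plane measure" where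
  "rotate_measure R \<rho> = distr \<rho> (restrict_space borel S1) (\<lambda>x. R *v x)"

text \<open>Regularity is automatic for finite Borel measures on the circle.\<close>

lemma regular_on_circleI:
  assumes sets: "sets \<rho> = sets (restrict_space borel S1)" and "prob_space \<rho>"
  shows "regular_on_circle \<rho>"
proof -
  interpret prob_space \<rho> by fact
  define N where "N = distr \<rho> borel (\<lambda>x. x)"
  have sp: "space \<rho> = S1"
    using sets_eq_imp_space_eq[OF sets] by (simp add: space_restrict_space)
  have S1b: "S1 \<in> sets borel" by (simp add: borel_closed)
  have in_sets: "A \<in> sets \<rho> \<longleftrightarrow> A \<in> sets borel \<and> A \<subseteq> S1" for A
    unfolding sets using S1b by (auto simp: sets_restrict_space_iff)
  have meas: "(\<lambda>x. x) \<in> measurable \<rho> borel"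
    by (subst measurable_cong_sets[OF sets refl]) (rule measurable_restrict_space1, simp)
  have N: "emeasure N A = emeasure \<rho> (A \<inter> S1)" if "A \<in> sets borel" for A
    unfolding N_def using that by (subst emeasure_distr[OF meas]) (auto simp: sp)
  interpret N: prob_space N unfolding N_def by (rule prob_space_distr[OF meas])
  have sN: "sets N = sets borel" by (simp add: N_def)
  have fin: "emeasure N (space N) \<noteq> \<infinity>" by simp
  show ?thesis
    unfolding regular_on_circle_def
  proof (intro ballI conjI)
    fix A assume "A \<in> sets \<rho>"
    then have A: "A \<in> sets borel" "A \<subseteq> S1" by (auto simp: in_sets)
    have NA: "emeasure N A = emeasure \<rho> A"
      using N[OF A(1)] A(2) by (simp add: Int_absorb2)
    show "emeasure \<rho> A = (SUP K\<in>{K. K \<subseteq> A \<and> compact K}. emeasure \<rho> K)"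
      unfolding NA[symmetric] inner_regular[OF sN fin A(1)]
    proof (rule SUP_cong[OF refl])
      fix K assume "K \<in> {K. K \<subseteq> A \<and> compact K}"
      then have "K \<in> sets borel" "K \<subseteq> S1" using A(2) by (auto simp: borel_compact)
      then show "emeasure N K = emeasure \<rho> K" using N by (simp add: Int_absorb2)
    qed
    show "emeasure \<rho> A = (INF U\<in>{U. A \<subseteq> U \<and> openin (top_of_set S1) U}. emeasure \<rho> U)"
    proof (rule antisym)
      show "emeasure \<rho> A \<le> (INF U\<in>{U. A \<subseteq> U \<and> openin (top_of_set S1) U}. emeasure \<rho> U)"
      proof (rule INF_greatest)
        fix U assume U: "U \<in> {U. A \<subseteq> U \<and> openin (top_of_set S1) U}"
        then obtain V where "open V" "U = S1 \<inter> V" by (auto simp: openin_open)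
        then have "U \<in> sets \<rho>" using S1b by (auto simp: in_sets)
        with U show "emeasure \<rho> A \<le> emeasure \<rho> U" by (auto intro: emeasure_mono)
      qed
      show "(INF U\<in>{U. A \<subseteq> U \<and> openin (top_of_set S1) U}. emeasure \<rho> U) \<le> emeasure \<rho> A"
        unfolding NA[symmetric] outer_regular[OF sN fin A(1)]
      proof (rule INF_mono)
        fix V assume V: "V \<in> {U. A \<subseteq> U \<and> open U}"
        then have "emeasure N V = emeasure \<rho> (V \<inter> S1)" by (intro N) auto
        with V A(2) show "\<exists>U\<in>{U. A \<subseteq> U \<and> openin (top_of_set S1) U}. emeasure \<rho> U \<le> emeasure N V"
          by (intro bexI[of _ "V \<inter> S1"]) (auto simp: openin_open)
      qed
    qed
  qed
qed

end

theory Submission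
  imports Defs
begin

text \<open>
  Write \<open>K\<close> for the kernel as a function of the angle and \<open>\<theta>\<close> for \<open>\<theta>\<^sub>m\<^sub>a\<^sub>x\<close>. A minimizer exists by
  compactness. Its potential \<open>\<integral> L(x,y) d\<rho>(y)\<close> is at least the minimal action everywhere, with equality
  on the support, and by the second variation the kernel is positive semidefinite on the support.

  On \<open>[0, \<theta>]\<close> the kernel is strictly concave, so near a support point without a partner at distance
  \<open>\<theta>\<close> the potential would be concave: every support point has a partner. As
  \<open>K(u)\<^sup>2 + K(\<theta> - u)\<^sup>2 > K(0)\<^sup>2\<close> for \<open>0 < u < \<theta>\<close>, semidefiniteness leaves no support point between two
  partners; hence the support is finite. A gap longer than \<open>\<theta>\<close> would contain a point of too small
  potential, and with two gaps shorter than \<open>\<theta>\<close> the arc between them could be moved so as to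
  decrease the action. So all gaps but at most one equal \<open>\<theta>\<close>, and the weights follow from the
  potential being constant on the support.
\<close>

section \<open>Properties of the kernel\<close>

text \<open>The kernel is strictly concave inside \<theta> and vanishes outside, so its only
  convexity is the kink at \<theta>. A small motion of a pair at any other distance, forwards and
  backwards, does not raise the mean of the two kernel values; a minimizer is held in place only by
  pairs at distance exactly \<theta>, and this is where the step of the chain comes from. The bound
  on \<tau> enters through \<tau>^2 > 6.15 in two places. Concavity all the way up to \<theta> needs
  \<tau>^2 > 6. The inequality for K(u)^2 + K(\<theta> - u)^2 turns into an equality at u = 0 and u
  = \<theta>, with vanishing first derivative; the second-order coefficient there is positive iff 1
  - 7q + 6q^2 - 2q^3 > 0 for q = 1/\<tau>^2, that is for q below about 0.165.\<close>

lemma D_poly_alt: "D_poly \<tau> c = 2 * \<tau>\<^sup>2 * (2 - \<tau>\<^sup>2 + 2 * c + \<tau>\<^sup>2 * c\<^sup>2)"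
  by (simp add: D_poly_def algebra_simps power2_eq_square)

lemma L_angle_minus [simp]: "L_angle \<tau> (- u) = L_angle \<tau> u"
  by (simp add: L_angle_def D_angle_def)

lemma L_angle_nonneg [simp]: "0 \<le> L_angle \<tau> u"
  by (simp add: L_angle_def)

lemma L_angle_commute: "L_angle \<tau> (a - b) = L_angle \<tau> (b - a)"
  using L_angle_minus[of \<tau> "a - b"] by simp

lemma L_angle_cong: "cos u = cos v \<Longrightarrow> L_angle \<tau> u = L_angle \<tau> v"
  by (simp add: L_angle_def D_angle_def)

text \<open>Later \<open>p = cos (\<theta>/2)\<close>, \<open>w = cos (u - \<theta>/2)\<close> and \<open>q = 1/\<tau>\<^sup>2\<close>. The two sides of
  \<open>K(u)\<^sup>2 + K(\<theta> - u)\<^sup>2 > K(0)\<^sup>2\<close> agree to first order at \<open>u = \<theta>\<close>, whence the double zero at \<open>w = p\<close>.\<close>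

lemma key_factorization:
  fixes p w :: real
  defines "q \<equiv> 1 - p\<^sup>2"
  shows "(q - 1/2 + q * (p * w) + ((p * w)\<^sup>2 + q * (1 - w\<^sup>2)) / 2)\<^sup>2
      + q * (1 - w\<^sup>2) * (q + p * w)\<^sup>2 - 2 * q\<^sup>2
    = (w - p)\<^sup>2 * ((1/4 - 2 * q + 2 * q\<^sup>2) * w\<^sup>2 + p * (1/2 - 3 * q) * w + (1/4 - 5/4 * q - q\<^sup>2))"
  unfolding q_def by (simp add: field_simps power2_eq_square)

text \<open>Only the leading coefficient can be negative. In that case w^2 is bounded by 1 and p * w
  from below by p^2 = 1 - q, which leaves 1 - 27/4 q + 4 q^2. Its smaller root is about 0.164, and
  163/1000 is a rational between 1/6.15 and that root.\<close>

lemma key_factor_pos: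
  fixes p w q :: real
  assumes q: "0 < q" "q < 163/1000" "p\<^sup>2 = 1 - q" and w: "0 < p" "p \<le> w" "w \<le> 1"
  shows "0 < (1/4 - 2 * q + 2 * q\<^sup>2) * w\<^sup>2 + p * (1/2 - 3 * q) * w + (1/4 - 5/4 * q - q\<^sup>2)"
proof -
  let ?e = "1/4 - 2 * q + 2 * q\<^sup>2" and ?g = "1/4 - 5/4 * q - q\<^sup>2"
  have qq: "q\<^sup>2 \<le> 163/1000 * q"
    unfolding power2_eq_square using q by (intro mult_right_mono) auto
  have g: "0 < ?g" using qq q by simp
  have pw: "1 - q \<le> p * w"
    using mult_left_mono[of p w p] w unfolding q(3)[symmetric] power2_eq_square by simp
  have lin: "0 < 1/2 - 3 * q" using q by simp
  have mid: "(1 - q) * (1/2 - 3 * q) \<le> p * (1/2 - 3 * q) * w"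
    using mult_right_mono[OF pw, of "1/2 - 3 * q"] lin by (simp add: mult_ac)
  have mid0: "0 \<le> (1 - q) * (1/2 - 3 * q)" using lin q by simp
  show ?thesis
  proof (cases "?e \<ge> 0")
    case True
    then have "0 \<le> ?e * w\<^sup>2" by simp
    with g mid mid0 show ?thesis by linarith
  next
    case False
    have "w\<^sup>2 \<le> 1" using w by (simp add: power_le_one)
    then have "?e * 1 \<le> ?e * w\<^sup>2"
      by (rule mult_left_mono_neg) (use False in simp)
    then have "?e \<le> ?e * w\<^sup>2" by simp
    moreover have "0 < ?e + (1 - q) * (1/2 - 3 * q) + ?g"
    proof -
      have "?e + (1 - q) * (1/2 - 3 * q) + ?g = 1 - 27/4 * q + 4 * q\<^sup>2"
        by (simp add: field_simps power2_eq_square)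
      \<comment> \<open>Division by 163/1000 - q with remainder: the remainder is the value at
        163/1000, and the quotient is positive for smaller q.\<close>
      also have "\<dots> = (163/1000 - q) * (27/4 - 4 * (163/1000) - 4 * q) + (1 - 27/4*(163/1000) + 4 * (163/1000)\<^sup>2)"
        by (simp add: field_simps power2_eq_square)
      also have "\<dots> > 0"
        using q by (intro add_nonneg_pos[OF mult_nonneg_nonneg]) (auto simp: power2_eq_square)
      finally show ?thesis .
    qed
    moreover have "0 < A + B + g" if "e \<le> A" "0 < e + m + g" "m \<le> B" for A B e m g :: real
      using that by linarith
    ultimately show ?thesis using mid by blast
  qed
qed

lemma zero_less_mult_iff_pos: "0 < a \<Longrightarrow> 0 < a * b \<longleftrightarrow> 0 < (b :: real)"
  by (simp add: zero_less_mult_iff)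

section \<open>Sign, maximum and concavity of the kernel as a function of the angle\<close>

locale large_tau =
  fixes \<tau> :: real
  assumes tau: "\<tau> > sqrt (3 + sqrt 10)"
begin

abbreviation \<theta> :: real where "\<theta> \<equiv> theta_max \<tau>"
abbreviation K :: "real \<Rightarrow> real" where "K \<equiv> L_angle \<tau>"

lemma tau_sq: "\<tau>\<^sup>2 > 615/100"
proof -
  have "(315/100)\<^sup>2 \<le> (10::real)" by (simp add: power2_eq_square)
  then have s: "315/100 \<le> sqrt (10::real)" by (rule real_le_rsqrt)
  then have "sqrt (615/100) \<le> sqrt (3 + sqrt 10)" by simp
  with tau have "sqrt (615/100) < \<tau>" by linarith
  then have "(sqrt (615/100))\<^sup>2 < \<tau>\<^sup>2" by (intro power_strict_mono) auto
  then show ?thesis by simp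
qed

lemma tau_sq_pos [simp]: "0 < \<tau>\<^sup>2" "\<tau> \<noteq> 0"
  using tau_sq by auto

lemma cos_theta: "cos \<theta> = 1 - 2 / \<tau>\<^sup>2"
  unfolding theta_max_def using tau_sq by (intro cos_arccos) (auto simp: field_simps)

lemma cos_theta_bounds: "0 < cos \<theta>" "cos \<theta> < 1"
  unfolding cos_theta using tau_sq by (auto simp: field_simps)

lemma theta_bounds: "0 < \<theta>" "\<theta> < pi / 2"
proof -
  have c: "1 - 2 / \<tau>\<^sup>2 < 1" "0 < 1 - 2 / \<tau>\<^sup>2" using cos_theta_bounds by (auto simp: cos_theta)
  show "0 < \<theta>" unfolding theta_max_def using arccos_less_arccos[of "1 - 2 / \<tau>\<^sup>2" 1] c by simp
  show "\<theta> < pi / 2" unfolding theta_max_def using arccos_less_arccos[of 0 "1 - 2 / \<tau>\<^sup>2"] c by simp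
qed

lemma D_poly_pos_iff: "-1 < c \<Longrightarrow> 0 < D_poly \<tau> c \<longleftrightarrow> cos \<theta> < c"
proof -
  assume "-1 < c"
  then have "0 < D_poly \<tau> c \<longleftrightarrow> 0 < 2 - \<tau>\<^sup>2 * (1 - c)"
    unfolding D_poly_def by - (rule zero_less_mult_iff_pos, auto)
  also have "\<dots> \<longleftrightarrow> cos \<theta> < c"
    by (simp add: cos_theta field_simps)
  finally show ?thesis .
qed

lemma K_eq_D: "cos \<theta> \<le> cos u \<Longrightarrow> K u = D_poly \<tau> (cos u)"
proof -
  assume u: "cos \<theta> \<le> cos u"
  have "0 \<le> 2 - \<tau>\<^sup>2 * (1 - cos u)" using u by (simp add: cos_theta field_simps)
  moreover have "0 \<le> 1 + cos u" using u cos_theta_bounds by linarith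
  ultimately have "0 \<le> D_poly \<tau> (cos u)" by (simp add: D_poly_def)
  then show ?thesis by (simp add: L_angle_def D_angle_def)
qed

lemma K_pos_iff: "0 < K u \<longleftrightarrow> cos \<theta> < cos u"
proof (cases "cos u = -1")
  case True
  then show ?thesis using cos_theta_bounds by (simp add: L_angle_def D_angle_def D_poly_def)
next
  case False
  then have "-1 < cos u" using cos_ge_minus_one[of u] by linarith
  then show ?thesis using D_poly_pos_iff[of "cos u"] by (auto simp: L_angle_def D_angle_def)
qed

lemma K_eq_0_iff: "K u = 0 \<longleftrightarrow> cos u \<le> cos \<theta>"
  using K_pos_iff[of u] L_angle_nonneg[of \<tau> u] by linarith

lemma K_theta [simp]: "K \<theta> = 0"
  by (simp add: K_eq_0_iff)

lemma K_0: "K 0 = 8 * \<tau>\<^sup>2"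
  using cos_theta_bounds by (subst K_eq_D) (auto simp: D_poly_def)

lemma K_0_pos: "0 < K 0"
  by (simp add: K_0)

lemma K_less: "cos u < 1 \<Longrightarrow> K u < K 0"
proof -
  assume u: "cos u < 1"
  show ?thesis
  proof (cases "cos \<theta> < cos u")
    case True
    have "(1 + cos u) * (2 - \<tau>\<^sup>2 * (1 - cos u)) < 2 * 2"
      using u True cos_theta_bounds by (intro mult_strict_mono) (auto simp: cos_theta field_simps)
    then have "(2 * \<tau>\<^sup>2) * ((1 + cos u) * (2 - \<tau>\<^sup>2 * (1 - cos u))) < (2 * \<tau>\<^sup>2) * (2 * 2)"
      by (intro mult_strict_left_mono) auto
    then show ?thesis using True by (simp add: K_0 K_eq_D D_poly_def mult_ac)
  next
    case False
    then have "K u = 0" by (simp add: K_eq_0_iff)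
    then show ?thesis using K_0_pos by simp
  qed
qed

text \<open>An exact identity in place of a second derivative: D is quadratic in the cosine, so its
  symmetric second difference splits off 1 - cos h without a remainder term.\<close>

lemma D_second_difference:
  "D_poly \<tau> (cos (u + h)) + D_poly \<tau> (cos (u - h)) - 2 * D_poly \<tau> (cos u)
    = - 2 * \<tau>\<^sup>2 * (1 - cos h) * (4 * cos u + 2 * \<tau>\<^sup>2 * (2 * (cos u)\<^sup>2 - 1) * (1 + cos h))"
proof -
  let ?c = "cos u" and ?s = "sin u" and ?d = "cos h" and ?r = "sin h"
  have s: "?s^2 = 1 - ?c^2" "?r^2 = 1 - ?d^2" by (simp_all add: sin_squared_eq)
  have "(?c * ?d - ?s * ?r)\<^sup>2 + (?c * ?d + ?s * ?r)\<^sup>2 = 2 * (?c^2 * ?d^2 + ?s^2 * ?r^2)"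
    by (simp add: power2_eq_square algebra_simps)
  also have "\<dots> = 2 * (?c^2 * ?d^2 + (1 - ?c^2) * (1 - ?d^2))" by (simp add: s)
  finally have sq: "(cos (u + h))\<^sup>2 + (cos (u - h))\<^sup>2 = 2 * (?c^2 * ?d^2 + (1 - ?c^2) * (1 - ?d^2))"
    by (simp add: cos_add cos_diff)
  have lin: "cos (u + h) + cos (u - h) = 2 * ?c * ?d" by (simp add: cos_add cos_diff)
  have "D_poly \<tau> (cos (u + h)) + D_poly \<tau> (cos (u - h)) - 2 * D_poly \<tau> (cos u)
    = 2 * \<tau>\<^sup>2 * (2 * (cos (u + h) + cos (u - h)) + \<tau>\<^sup>2 * ((cos (u + h))\<^sup>2 + (cos (u - h))\<^sup>2)
        - 4 * ?c - 2 * \<tau>\<^sup>2 * ?c\<^sup>2)"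
    by (simp add: D_poly_alt algebra_simps)
  also have "\<dots> = - 2 * \<tau>\<^sup>2 * (1 - ?d) * (4 * ?c + 2 * \<tau>\<^sup>2 * (2 * ?c\<^sup>2 - 1) * (1 + ?d))"
    unfolding lin sq by (simp add: algebra_simps power2_eq_square)
  finally show ?thesis .
qed

text \<open>If \<open>cos 2u < 0\<close>, the last factor of the second difference is bounded below by its value at \<open>u = \<theta>\<close>, \<open>h = 0\<close>,
  which is positive because \<open>\<tau>\<^sup>2 > 6\<close>.\<close>

lemma D_strictly_concave:
  assumes u: "cos \<theta> \<le> cos u" and h: "cos h < 1"
  shows "D_poly \<tau> (cos (u + h)) + D_poly \<tau> (cos (u - h)) < 2 * D_poly \<tau> (cos u)"
proof -
  have "0 < 4 * cos u + 2 * \<tau>\<^sup>2 * (2 * (cos u)\<^sup>2 - 1) * (1 + cos h)"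
  proof (cases "0 \<le> 2 * (cos u)\<^sup>2 - 1")
    case True
    then have "0 \<le> 2 * \<tau>\<^sup>2 * (2 * (cos u)\<^sup>2 - 1) * (1 + cos h)"
      using cos_ge_minus_one[of h] by (intro mult_nonneg_nonneg) (simp, simp, assumption, linarith)
    then show ?thesis using u cos_theta_bounds by linarith
  next
    case False
    have c2: "(cos \<theta>)\<^sup>2 \<le> (cos u)\<^sup>2" using u cos_theta_bounds by (intro power_mono) auto
    have "2 * \<tau>\<^sup>2 * (2 * (cos u)\<^sup>2 - 1) * 2 \<le> 2 * \<tau>\<^sup>2 * (2 * (cos u)\<^sup>2 - 1) * (1 + cos h)"
      using False cos_le_one[of h] by (intro mult_left_mono_neg) (auto simp: mult_le_0_iff)
    moreover have "2 * \<tau>\<^sup>2 * (2 * (cos \<theta>)\<^sup>2 - 1) * 2 \<le> 2 * \<tau>\<^sup>2 * (2 * (cos u)\<^sup>2 - 1) * 2"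
      using c2 by (intro mult_right_mono mult_left_mono) auto
    moreover have "4 * cos \<theta> + 2 * \<tau>\<^sup>2 * (2 * (cos \<theta>)\<^sup>2 - 1) * 2 = 4 * (\<tau>\<^sup>2 - 1) * (\<tau>\<^sup>2 - 6) / \<tau>\<^sup>2"
      by (simp add: cos_theta field_simps power2_eq_square)
    moreover have "0 < 4 * (\<tau>\<^sup>2 - 1) * (\<tau>\<^sup>2 - 6) / \<tau>\<^sup>2"
      using tau_sq by (intro divide_pos_pos mult_pos_pos) auto
    ultimately show ?thesis using u by linarith
  qed
  then have "0 < 2 * \<tau>\<^sup>2 * (1 - cos h) * (4 * cos u + 2 * \<tau>\<^sup>2 * (2 * (cos u)\<^sup>2 - 1) * (1 + cos h))"
    using h by (intro mult_pos_pos) auto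
  then show ?thesis using D_second_difference[of u h] by linarith
qed

lemma cos_shift_le: "\<bar>cos (u + h) - cos u\<bar> \<le> \<bar>h :: real\<bar>"
proof -
  have "norm (cos (u + h) - cos u) \<le> 1 * norm (u + h - u)"
    by (rule differentiable_bound[of UNIV cos "\<lambda>x d. - sin x * d"])
       (auto intro!: derivative_eq_intros onorm_le simp: has_field_derivative_def[symmetric] abs_mult
          mult_left_le_one_le)
  then show ?thesis by simp
qed

text \<open>As cos is 1-Lipschitz, the bound on h keeps u + h and u - h on the same side of the kink
  as u. Inside, strict concavity applies; outside, all three values are 0.\<close>

lemma K_second_difference:
  assumes "0 < h" "h \<le> 1" "h \<le> \<bar>cos u - cos \<theta>\<bar>"
  shows "K (u + h) + K (u - h) \<le> 2 * K u" and "cos \<theta> < cos u \<Longrightarrow> K (u + h) + K (u - h) < 2 * K u"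
proof -
  have b: "\<bar>cos (u + h) - cos u\<bar> \<le> h" "\<bar>cos (u - h) - cos u\<bar> \<le> h"
    using cos_shift_le[of u h] cos_shift_le[of u "-h"] assms by auto
  have h1: "cos h < 1"
    using cos_monotone_0_pi[of 0 h] assms pi_gt3 by simp
  show strict: "K (u + h) + K (u - h) < 2 * K u" if "cos \<theta> < cos u"
  proof -
    have "cos \<theta> \<le> cos (u + h)" "cos \<theta> \<le> cos (u - h)" using that assms b by linarith+
    then show ?thesis using that D_strictly_concave[of u h] h1 by (simp add: K_eq_D)
  qed
  show "K (u + h) + K (u - h) \<le> 2 * K u"
  proof (cases "cos \<theta> < cos u")
    case False
    then have "cos (u + h) \<le> cos \<theta>" "cos (u - h) \<le> cos \<theta>" using assms b by linarith+
    then have "K (u + h) = 0" "K (u - h) = 0" by (auto simp: K_eq_0_iff)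
    then show ?thesis by simp
  qed (use strict in force)
qed

text \<open>Measured from the midpoint \<theta>/2, exchanging u and \<theta> - u is a change of sign
  of v. The sum of squares is therefore even in v and a polynomial in w = cos v, to which
  \<open>key_factorization\<close> applies.\<close>

lemma key_inequality:
  assumes u: "0 < u" "u < \<theta>"
  shows "(K 0)\<^sup>2 < (K u)\<^sup>2 + (K (\<theta> - u))\<^sup>2"
proof -
  let ?t = "\<tau>\<^sup>2"
  define \<alpha> v where "\<alpha> = \<theta> / 2" and "v = u - \<alpha>"
  define p w q where "p = cos \<alpha>" and "w = cos v" and "q = 1 / ?t"
  have q: "0 < q" "q < 163/1000" "?t = 1 / q"
    using tau_sq by (auto simp: q_def field_simps)
  have al: "0 < \<alpha>" "\<alpha> < pi / 2" using theta_bounds by (auto simp: \<alpha>_def)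
  have "cos \<theta> = 2 * p\<^sup>2 - 1" using cos_double_cos[of \<alpha>] by (simp add: \<alpha>_def p_def)
  then have pq: "p\<^sup>2 = 1 - q" by (simp add: cos_theta q_def)
  have p0: "0 < p" unfolding p_def using al by (intro cos_gt_zero_pi) auto
  have "\<bar>v\<bar> < \<alpha>" using u by (simp add: v_def \<alpha>_def abs_if field_simps)
  then have "cos \<alpha> < cos \<bar>v\<bar>" using al by (intro cos_monotone_0_pi) auto
  then have pw: "p < w" by (simp add: p_def w_def abs_if split: if_splits)
  have w1: "w \<le> 1" by (simp add: w_def)
  define X Y where "X = p * w" and "Y = sin \<alpha> * sin v"
  have Y2: "Y\<^sup>2 = q * (1 - w\<^sup>2)"
  proof -
    have "Y\<^sup>2 = (1 - (cos \<alpha>)\<^sup>2) * (1 - (cos v)\<^sup>2)"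
      by (simp add: Y_def power_mult_distrib sin_squared_eq)
    then show ?thesis using pq by (simp add: p_def w_def)
  qed
  have uav: "u = \<alpha> + v" "\<theta> - u = \<alpha> - v" by (auto simp: v_def \<alpha>_def)
  have cu: "cos u = X - Y" "cos (\<theta> - u) = X + Y"
    using arg_cong[OF uav(1), of cos] arg_cong[OF uav(2), of cos]
    by (simp_all only: cos_add[of \<alpha> v] cos_diff[of \<alpha> v] X_def Y_def p_def w_def)
  \<comment> \<open>The two kernel values in units of K 0 = 8 \<tau>^2. Their sum is even in Y and
    their difference odd; (a + b)^2 + (a - b)^2 is twice the wanted sum of squares.\<close>
  define a b where "a = (2 - ?t + 2 * (X - Y) + ?t * (X - Y)\<^sup>2) / 4"
    and "b = (2 - ?t + 2 * (X + Y) + ?t * (X + Y)\<^sup>2) / 4"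
  have "cos \<theta> \<le> cos u" "cos \<theta> \<le> cos (\<theta> - u)"
    using u theta_bounds by (auto intro!: cos_monotone_0_pi_le)
  then have Ka: "K u = 8 * ?t * a" and Kb: "K (\<theta> - u) = 8 * ?t * b"
    by (simp_all add: K_eq_D D_poly_alt cu a_def b_def)
  have ab1: "q * (a + b) = q - 1/2 + q * (p * w) + ((p * w)\<^sup>2 + q * (1 - w\<^sup>2)) / 2"
  proof -
    have "a + b = (2 - ?t) / 2 + X + ?t * (X\<^sup>2 + Y\<^sup>2) / 2"
      by (simp add: a_def b_def power2_eq_square field_simps)
    then have "q * (a + b) = q * ((2 - ?t) / 2 + X + ?t * (X\<^sup>2 + Y\<^sup>2) / 2)" by simp
    also have "\<dots> = q - (q * ?t) / 2 + q * X + (q * ?t) * (X\<^sup>2 + Y\<^sup>2) / 2"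
      by (simp add: field_simps)
    finally have "q * (a + b) = q - (q * ?t) / 2 + q * X + (q * ?t) * (X\<^sup>2 + Y\<^sup>2) / 2" .
    then show ?thesis using q by (simp add: Y2 X_def)
  qed
  have "(q * (a - b))\<^sup>2 = Y\<^sup>2 * (q + X)\<^sup>2"
  proof -
    have "a - b = - Y * (1 + ?t * X)" by (simp add: a_def b_def power2_eq_square field_simps)
    then have "q * (a - b) = - Y * (q + X)" using q by (simp add: field_simps)
    then show ?thesis by (simp add: power_mult_distrib)
  qed
  then have ab2: "(q * (a - b))\<^sup>2 = q * (1 - w\<^sup>2) * (q + p * w)\<^sup>2" by (simp add: Y2 X_def)
  have "q\<^sup>2 * ((a + b)\<^sup>2 + (a - b)\<^sup>2 - 2) = (q * (a + b))\<^sup>2 + (q * (a - b))\<^sup>2 - 2 * q\<^sup>2"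
    by (simp add: power2_eq_square algebra_simps)
  also have "\<dots> = (w - p)\<^sup>2 * ((1/4 - 2 * q + 2 * q\<^sup>2) * w\<^sup>2 + p * (1/2 - 3 * q) * w + (1/4 - 5/4 * q - q\<^sup>2))"
    unfolding ab1 ab2 using key_factorization[of p w] pq by simp
  also have "\<dots> > 0"
    using key_factor_pos[of q p w] q pq p0 pw w1 by (intro mult_pos_pos) auto
  finally have "0 < (a + b)\<^sup>2 + (a - b)\<^sup>2 - 2" using q by (simp add: zero_less_mult_iff)
  then have "1 < a\<^sup>2 + b\<^sup>2" by (simp add: power2_eq_square algebra_simps)
  then have "(8 * ?t)\<^sup>2 * 1 < (8 * ?t)\<^sup>2 * (a\<^sup>2 + b\<^sup>2)" by (intro mult_strict_left_mono) auto
  then show ?thesis by (simp add: K_0 Ka Kb power_mult_distrib distrib_left)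
qed

end

section \<open>Measures on the circle and existence of minimizers\<close>

definition circ :: "real \<Rightarrow> plane" where
  "circ s = vector [cos s, sin s]"

lemma circ_nth [simp]: "circ s $ 1 = cos s" "circ s $ 2 = sin s"
  by (simp_all add: circ_def)

lemma circ_inner: "circ a \<bullet> circ b = cos (a - b)"
  by (simp add: inner_vec_def sum_2 cos_diff)

lemma norm_circ [simp]: "norm (circ s) = 1"
  by (simp add: norm_eq_sqrt_inner circ_inner)

lemma circ_in_S1: "circ s \<in> S1"
  by simp

lemma S1_inner: "x \<in> S1 \<Longrightarrow> x \<bullet> x = 1"
  by (simp add: norm_eq_sqrt_inner)

lemma circ_surj:
  assumes "x \<in> S1" obtains s where "x = circ s"
proof -
  have "(x $ 1)\<^sup>2 + (x $ 2)\<^sup>2 = 1"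
    using S1_inner[OF assms] by (simp add: inner_vec_def sum_2 power2_eq_square)
  then obtain s where "x $ 1 = cos s" "x $ 2 = sin s" by (rule sincos_total_2pi)
  then have "x = circ s" by (simp add: vec_eq_iff forall_2)
  then show ?thesis by (rule that)
qed

lemma continuous_on_circ [continuous_intros]:
  fixes f :: "real \<Rightarrow> real"
  assumes "continuous_on A f" shows "continuous_on A (\<lambda>s. circ (f s))"
proof -
  have "continuous_on A (\<lambda>s. \<chi> i. circ (f s) $ i)"
  proof (rule continuous_on_vec_lambda)
    fix i :: 2
    show "continuous_on A (\<lambda>s. circ (f s) $ i)"
      using exhaust_2[of i] continuous_on_cos[OF assms] continuous_on_sin[OF assms] by auto
  qed
  then show ?thesis by simp
qed

lemma inner_S1_bound: "x \<in> S1 \<Longrightarrow> y \<in> S1 \<Longrightarrow> \<bar>x \<bullet> y\<bar> \<le> 1"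
  using Cauchy_Schwarz_ineq2[of x y] by simp

lemma circ_eq_iff: "circ a = circ b \<longleftrightarrow> cos (a - b) = 1"
proof
  assume "cos (a - b) = 1"
  then have "(circ a - circ b) \<bullet> (circ a - circ b) = 0"
    by (simp add: inner_diff_left inner_diff_right circ_inner cos_diff algebra_simps)
  then show "circ a = circ b" by simp
next
  assume "circ a = circ b"
  then show "cos (a - b) = 1" using circ_inner[of a b] circ_inner[of b b] by simp
qed

lemma circ_periodic [simp]: "circ (s + 2 * pi) = circ s" "circ (s - 2 * pi) = circ s"
  by (simp_all add: circ_eq_iff)

lemma L_fun_circ: "L_fun \<tau> (circ a) (circ b) = L_angle \<tau> (a - b)"
  by (simp add: L_fun_def D_fun_def L_angle_def D_angle_def circ_inner)

lemma L_fun_commute: "L_fun \<tau> x y = L_fun \<tau> y x"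
  by (simp add: L_fun_def D_fun_def inner_commute)

lemma L_fun_nonneg [simp]: "0 \<le> L_fun \<tau> x y"
  by (simp add: L_fun_def)

lemma measurable_L_fun [measurable]:
  assumes [measurable]: "f \<in> borel_measurable M" "g \<in> borel_measurable M"
  shows "(\<lambda>x. L_fun \<tau> (f x) (g x)) \<in> borel_measurable M"
  unfolding L_fun_def D_fun_def D_poly_def by measurable

text \<open>One constant that serves both as supremum bound and as Lipschitz constant of the kernel;
  only its finiteness matters.\<close>

definition L_bound :: "real \<Rightarrow> real" where
  "L_bound \<tau> = 4 * \<tau>\<^sup>2 * (2 + 2 * \<tau>\<^sup>2)"

lemma L_bound_nonneg [simp]: "0 \<le> L_bound \<tau>"
  by (simp add: L_bound_def)

lemma L_fun_le:
  assumes "x \<in> S1" "y \<in> S1" shows "L_fun \<tau> x y \<le> L_bound \<tau>"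
proof -
  have b: "\<bar>x \<bullet> y\<bar> \<le> 1" using assms by (rule inner_S1_bound)
  have b1: "2 - \<tau>\<^sup>2 * (1 - x \<bullet> y) \<le> 2 + 2 * \<tau>\<^sup>2"
    using mult_nonneg_nonneg[of "\<tau>\<^sup>2" "1 - x \<bullet> y"] b by (simp add: abs_le_iff add_increasing2 del: mult_nonneg_nonneg)
  have "D_fun \<tau> x y \<le> 2 * \<tau>\<^sup>2 * (1 + x \<bullet> y) * (2 + 2 * \<tau>\<^sup>2)"
    unfolding D_fun_def D_poly_def using b b1 by (intro mult_left_mono) auto
  also have "\<dots> \<le> 4 * \<tau>\<^sup>2 * (2 + 2 * \<tau>\<^sup>2)"
    using b mult_left_mono[of "1 + x \<bullet> y" 2 "2 * \<tau>\<^sup>2"] by (intro mult_right_mono) auto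
  finally show ?thesis by (simp add: L_fun_def L_bound_def)
qed

lemma L_fun_lipschitz:
  assumes "x \<in> S1" "x' \<in> S1" "y \<in> S1"
  shows "\<bar>L_fun \<tau> x y - L_fun \<tau> x' y\<bar> \<le> L_bound \<tau> * norm (x - x')"
proof -
  let ?c = "x \<bullet> y" and ?d = "x' \<bullet> y"
  have b: "\<bar>?c\<bar> \<le> 1" "\<bar>?d\<bar> \<le> 1" using assms by (auto intro!: inner_S1_bound)
  have "D_poly \<tau> ?c - D_poly \<tau> ?d = 2 * \<tau>\<^sup>2 * (2 + \<tau>\<^sup>2 * (?c + ?d)) * (?c - ?d)"
    by (simp add: D_poly_def algebra_simps power2_eq_square)
  then have "\<bar>D_poly \<tau> ?c - D_poly \<tau> ?d\<bar> = 2 * \<tau>\<^sup>2 * \<bar>2 + \<tau>\<^sup>2 * (?c + ?d)\<bar> * \<bar>?c - ?d\<bar>"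
    by (simp add: abs_mult)
  also have "\<dots> \<le> 2 * \<tau>\<^sup>2 * (2 + 2 * \<tau>\<^sup>2) * norm (x - x')"
  proof (intro mult_mono mult_nonneg_nonneg)
    have "\<bar>\<tau>\<^sup>2 * (?c + ?d)\<bar> \<le> \<tau>\<^sup>2 * 2"
      unfolding abs_mult using b by (intro mult_mono) auto
    then show "\<bar>2 + \<tau>\<^sup>2 * (?c + ?d)\<bar> \<le> 2 + 2 * \<tau>\<^sup>2" by linarith
    show "\<bar>?c - ?d\<bar> \<le> norm (x - x')"
      using Cauchy_Schwarz_ineq2[of "x - x'" y] assms(3) by (simp add: inner_diff_left)
  qed auto
  also have "\<dots> \<le> L_bound \<tau> * norm (x - x')"
    unfolding L_bound_def by (intro mult_right_mono) auto
  finally show ?thesis by (auto simp: L_fun_def D_fun_def max_def)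
qed

lemma L_fun_lipschitz2:
  assumes "x \<in> S1" "x' \<in> S1" "y \<in> S1" "y' \<in> S1"
  shows "\<bar>L_fun \<tau> x y - L_fun \<tau> x' y'\<bar> \<le> L_bound \<tau> * (norm (x - x') + norm (y - y'))"
  using L_fun_lipschitz[of x x' y \<tau>] L_fun_lipschitz[of y y' x' \<tau>] assms
  by (auto simp: L_fun_commute[of \<tau> x'] distrib_left)

section \<open>Borel probability measures on the circle and their potentials\<close>

lemma S1_borel [measurable]: "S1 \<in> sets borel"
  by (simp add: borel_closed)

lemma normalized_measures_iff:
  "\<rho> \<in> normalized_measures \<longleftrightarrow> sets \<rho> = sets (restrict_space borel S1) \<and> prob_space \<rho>"
  by (auto simp: normalized_measures_def regular_on_circleI)

text \<open>By \<open>circle_measure_iff\<close> this is membership in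
  \<open>normalized_measures\<close>; the regularity demanded there comes from
  \<open>regular_on_circleI\<close>.\<close>

locale circle_measure = prob_space \<rho> for \<rho> :: "plane measure" +
  assumes sets_rho: "sets \<rho> = sets (restrict_space borel S1)"
begin

lemma space_rho [simp]: "space \<rho> = S1"
  using sets_eq_imp_space_eq[OF sets_rho] by (simp add: space_restrict_space)

lemma in_sets: "A \<in> sets \<rho> \<longleftrightarrow> A \<in> sets borel \<and> A \<subseteq> S1"
  unfolding sets_rho by (auto simp: sets_restrict_space_iff)

lemma measurable_ident_rho [measurable]: "(\<lambda>x. x) \<in> borel_measurable \<rho>"
  by (subst measurable_cong_sets[OF sets_rho refl]) (rule measurable_restrict_space1, simp)

lemma openin_sets: "openin (top_of_set S1) U \<Longrightarrow> U \<in> sets \<rho>"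
  by (auto simp: openin_open in_sets)

lemma integrable_bounded:
  fixes f :: "plane \<Rightarrow> real"
  assumes "f \<in> borel_measurable \<rho>" "\<And>x. x \<in> S1 \<Longrightarrow> \<bar>f x\<bar> \<le> B"
  shows "integrable \<rho> f"
  using assms by (intro integrable_const_bound[where B = B]) auto

lemma integral_bounded:
  fixes f :: "plane \<Rightarrow> real"
  assumes "f \<in> borel_measurable \<rho>" "\<And>x. x \<in> S1 \<Longrightarrow> \<bar>f x\<bar> \<le> B"
  shows "\<bar>\<integral>x. f x \<partial>\<rho>\<bar> \<le> B"
proof -
  have "0 \<le> B" using assms(2)[of "circ 0"] by simp
  have "norm (\<integral>x. f x \<partial>\<rho>) \<le> (\<integral>x. norm (f x) \<partial>\<rho>)" by (rule integral_norm_bound)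
  also have "\<dots> \<le> (\<integral>x. B \<partial>\<rho>)"
    using assms integrable_bounded[OF assms] by (intro integral_mono) auto
  also have "\<dots> = B" using prob_space by simp
  finally show ?thesis by simp
qed

lemma abs_L_fun: "x \<in> S1 \<Longrightarrow> y \<in> S1 \<Longrightarrow> \<bar>L_fun \<tau> x y\<bar> \<le> L_bound \<tau>"
  using L_fun_le by simp

lemma integrable_L: "x \<in> S1 \<Longrightarrow> integrable \<rho> (\<lambda>y. L_fun \<tau> x y)"
  by (rule integrable_bounded[OF _ abs_L_fun]) auto

definition potential :: "real \<Rightarrow> plane \<Rightarrow> real" where
  "potential \<tau> x = (\<integral>y. L_fun \<tau> x y \<partial>\<rho>)"

lemma potential_measurable [measurable]: "potential \<tau> \<in> borel_measurable \<rho>"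
  unfolding potential_def by measurable

lemma potential_bounded: "x \<in> S1 \<Longrightarrow> \<bar>potential \<tau> x\<bar> \<le> L_bound \<tau>"
  unfolding potential_def by (rule integral_bounded) (auto intro: abs_L_fun[simplified])

lemma action_potential: "action \<tau> \<rho> = (\<integral>x. potential \<tau> x \<partial>\<rho>)"
  by (simp add: action_def potential_def)

lemma action_nonneg: "0 \<le> action \<tau> \<rho>"
  by (simp add: action_def)

lemma potential_lipschitz:
  assumes "x \<in> S1" "x' \<in> S1"
  shows "\<bar>potential \<tau> x - potential \<tau> x'\<bar> \<le> L_bound \<tau> * norm (x - x')"
proof -
  have "potential \<tau> x - potential \<tau> x' = (\<integral>y. L_fun \<tau> x y - L_fun \<tau> x' y \<partial>\<rho>)"
    unfolding potential_def using assms by (simp add: integrable_L)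
  also have "\<bar>\<dots>\<bar> \<le> L_bound \<tau> * norm (x - x')"
    using assms L_fun_lipschitz by (intro integral_bounded) auto
  finally show ?thesis .
qed

lemma continuous_on_potential: "continuous_on S1 (potential \<tau>)"
proof -
  have "(L_bound \<tau>)-lipschitz_on S1 (potential \<tau>)"
    by (rule lipschitz_onI) (use potential_lipschitz in \<open>auto simp: dist_norm\<close>)
  then show ?thesis by (rule lipschitz_on_continuous_on)
qed

end

lemma circle_measure_iff: "\<rho> \<in> normalized_measures \<longleftrightarrow> circle_measure \<rho>"
  by (auto simp: normalized_measures_iff circle_measure_def circle_measure_axioms_def)

text \<open>Apart from densities, all competitors are images of probability spaces under maps into
  the circle. This and the next two lemmas move their integrals and their action to the source
  space.\<close>

lemma circle_measure_distr:
  assumes "prob_space M" "f \<in> borel_measurable M" "\<And>x. x \<in> space M \<Longrightarrow> f x \<in> S1"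
  shows "circle_measure (distr M (restrict_space borel S1) f)"
    and "f \<in> measurable M (restrict_space borel S1)"
proof -
  show *: "f \<in> measurable M (restrict_space borel S1)"
    using assms by (intro measurable_restrict_space2) auto
  show "circle_measure (distr M (restrict_space borel S1) f)"
    unfolding circle_measure_def circle_measure_axioms_def
    using prob_space.prob_space_distr[OF assms(1) *] by simp
qed

lemma integral_distr_circle:
  fixes g :: "plane \<Rightarrow> real"
  assumes "prob_space M" "f \<in> borel_measurable M" "\<And>x. x \<in> space M \<Longrightarrow> f x \<in> S1"
    and "g \<in> borel_measurable (restrict_space borel S1)"
  shows "(\<integral>x. g x \<partial>distr M (restrict_space borel S1) f) = (\<integral>x. g (f x) \<partial>M)"
  using circle_measure_distr(2)[OF assms(1-3)] assms(4) by (intro integral_distr) auto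

lemma action_distr_circle:
  assumes "prob_space M" "f \<in> borel_measurable M" "\<And>x. x \<in> space M \<Longrightarrow> f x \<in> S1"
  shows "action \<tau> (distr M (restrict_space borel S1) f) = (\<integral>x. \<integral>y. L_fun \<tau> (f x) (f y) \<partial>M \<partial>M)"
proof -
  let ?N = "distr M (restrict_space borel S1) f"
  interpret N: circle_measure ?N by (rule circle_measure_distr(1)[OF assms])
  have m: "(\<lambda>y. L_fun \<tau> x y) \<in> borel_measurable (restrict_space borel S1)" for x
    by (intro measurable_restrict_space1) measurable
  have "N.potential \<tau> x = (\<integral>y. L_fun \<tau> x (f y) \<partial>M)" for x
    unfolding N.potential_def by (rule integral_distr_circle[OF assms m])
  moreover have "N.potential \<tau> \<in> borel_measurable (restrict_space borel S1)"
    using N.potential_measurable by simp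
  ultimately show ?thesis
    unfolding N.action_potential by (subst integral_distr_circle[OF assms]) auto
qed

section \<open>The minimal action and the existence of a minimizer\<close>

lemma bdd_below_action: "bdd_below (action \<tau> ` normalized_measures)"
  by (rule bdd_belowI[of _ 0]) (auto simp: circle_measure_iff circle_measure.action_nonneg)

lemma min_action_le: "circle_measure \<rho> \<Longrightarrow> min_action \<tau> \<le> action \<tau> \<rho>"
  unfolding min_action_def by (rule cINF_lower[OF bdd_below_action]) (simp add: circle_measure_iff)

lemma normalized_measures_nonempty: "normalized_measures \<noteq> {}"
proof -
  have "circle_measure (distr (measure_pmf (return_pmf ())) (restrict_space borel S1) (\<lambda>_. circ 0))"
    by (intro circle_measure_distr) (auto intro: prob_space_measure_pmf)
  then show ?thesis by (auto simp: circle_measure_iff[symmetric])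
qed

text \<open>A Borel section of \<open>circ\<close>. The clamp is the identity on the circle and
  makes the composition with arccos continuous on all reals.\<close>

definition angle_of :: "plane \<Rightarrow> real" where
  "angle_of x = (let c = max (-1) (min 1 (x $ 1)) in if 0 \<le> x $ 2 then arccos c else - arccos c)"

lemma angle_of_measurable [measurable]: "angle_of \<in> borel_measurable borel"
proof -
  have "continuous_on UNIV (\<lambda>r::real. arccos (max (-1) (min 1 r)))"
    by (intro continuous_intros) auto
  then have [measurable]: "(\<lambda>r::real. arccos (max (-1) (min 1 r))) \<in> borel_measurable borel"
    by (rule borel_measurable_continuous_onI)
  have [measurable]: "(\<lambda>x::plane. x $ i) \<in> borel_measurable borel" for i
    by (intro borel_measurable_continuous_onI continuous_intros)
  show ?thesis unfolding angle_of_def Let_def by measurable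
qed

lemma angle_of_bounds: "- pi \<le> angle_of x" "angle_of x \<le> pi"
proof -
  have "0 \<le> arccos (max (-1) (min 1 (x $ 1)))" "arccos (max (-1) (min 1 (x $ 1))) \<le> pi"
    by (auto intro!: arccos_lbound arccos_ubound)
  then show "- pi \<le> angle_of x" "angle_of x \<le> pi" by (auto simp: angle_of_def Let_def)
qed

lemma circ_angle_of:
  assumes "x \<in> S1" shows "circ (angle_of x) = x"
proof -
  have n: "(x $ 1)\<^sup>2 + (x $ 2)\<^sup>2 = 1"
    using S1_inner[OF assms] by (simp add: inner_vec_def sum_2 power2_eq_square)
  have "(x $ 1)\<^sup>2 \<le> 1" using n zero_le_power2[of "x $ 2"] by linarith
  then have b: "\<bar>x $ 1\<bar> \<le> 1" by (simp add: abs_square_le_1)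
  then have c: "max (-1) (min 1 (x $ 1)) = x $ 1" by (auto simp: abs_le_iff)
  have "1 - (x $ 1)\<^sup>2 = (x $ 2)\<^sup>2" using n by simp
  then have s: "sin (arccos (x $ 1)) = \<bar>x $ 2\<bar>" using b by (simp add: sin_arccos abs_le_iff)
  show ?thesis
    using b s by (auto simp: vec_eq_iff forall_2 angle_of_def c Let_def abs_le_iff cos_arccos)
qed

text \<open>Compactness: push a minimizing sequence to the line by the angle, extract a weakly convergent
  subsequence by Helly's theorem, realize it by an everywhere convergent sequence of random
  variables (Skorohod), and wrap back around the circle.\<close>

theorem minimizer_exists: "\<exists>\<rho>. minimizer \<tau> \<rho>"
proof -
  have "\<exists>\<rho>. circle_measure \<rho> \<and> action \<tau> \<rho> < min_action \<tau> + 1 / real (Suc n)" for n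
  proof -
    have "(INF \<rho>\<in>normalized_measures. action \<tau> \<rho>) < min_action \<tau> + 1 / real (Suc n)"
      unfolding min_action_def[symmetric] by simp
    then obtain a where "a \<in> action \<tau> ` normalized_measures" "a < min_action \<tau> + 1 / real (Suc n)"
      using cInf_lessD[of "action \<tau> ` normalized_measures"] normalized_measures_nonempty
      by blast
    then show ?thesis by (auto simp: circle_measure_iff)
  qed
  then obtain \<rho> where \<rho>: "\<And>n. circle_measure (\<rho> n)"
    and act: "\<And>n. action \<tau> (\<rho> n) < min_action \<tau> + 1 / real (Suc n)" by metis
  define \<mu> where "\<mu> n = distr (\<rho> n) borel angle_of" for n
  have ang: "angle_of \<in> borel_measurable (\<rho> n)" for n
    using measurable_compose[OF circle_measure.measurable_ident_rho[OF \<rho>] angle_of_measurable] by simp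
  have rd: "real_distribution (\<mu> n)" for n
    using prob_space.real_distribution_distr[OF _ ang] \<rho>[of n]
    by (simp add: \<mu>_def circle_measure_def)
  have "tight \<mu>"
    unfolding tight_def
  proof (intro conjI allI impI rd)
    fix \<epsilon> :: real assume "0 < \<epsilon>"
    \<comment> \<open>Tightness is free: all angles lie in [-pi, pi], and pi < 4.\<close>
    have "measure (\<mu> n) {-4<..4} = 1" for n
    proof -
      interpret circle_measure "\<rho> n" by (rule \<rho>)
      have "x \<in> angle_of -` {-4<..4}" for x
        using angle_of_bounds[of x] pi_less_4 by auto
      then have "angle_of -` {-4<..4} \<inter> space (\<rho> n) = space (\<rho> n)" by blast
      then show ?thesis unfolding \<mu>_def using ang by (simp add: measure_distr prob_space[simplified])
    qed
    with \<open>0 < \<epsilon>\<close> show "\<exists>a b::real. a < b \<and> (\<forall>n. measure (\<mu> n) {a<..b} > 1 - \<epsilon>)"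
      by (intro exI[of _ "-4"] exI[of _ 4]) auto
  qed
  from tight_imp_convergent_subsubsequence[OF this strict_mono_id]
  obtain r M where r: "strict_mono r" and M: "real_distribution M" and "weak_conv_m (\<mu> \<circ> id \<circ> r) M"
    by blast
  then have "weak_conv_m (\<lambda>n. \<mu> (r n)) M" by (simp add: o_def)
  from Skorohod[OF rd M this] obtain \<Omega> :: "real measure" and Y_seq Y where
    \<Omega>: "prob_space \<Omega>" and Yn [measurable]: "\<And>n. Y_seq n \<in> borel_measurable \<Omega>"
    and dYn: "\<And>n. distr \<Omega> borel (Y_seq n) = \<mu> (r n)" and "Y \<in> measurable \<Omega> lborel"
    and lim: "\<And>x. x \<in> space \<Omega> \<Longrightarrow> (\<lambda>n. Y_seq n x) \<longlonglongrightarrow> Y x"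
    by blast
  then have Y [measurable]: "Y \<in> borel_measurable \<Omega>" by simp
  interpret \<Omega>: prob_space \<Omega> by fact
  have circ_m [measurable]: "circ \<in> borel_measurable borel"
    by (intro borel_measurable_continuous_onI continuous_intros)
  have L_lim: "(\<lambda>n. L_fun \<tau> (circ (Y_seq n x)) (circ (Y_seq n y))) \<longlonglongrightarrow> L_fun \<tau> (circ (Y x)) (circ (Y y))"
    if "x \<in> space \<Omega>" "y \<in> space \<Omega>" for x y
    unfolding L_fun_circ L_angle_def D_angle_def D_poly_def using lim that by (intro tendsto_intros)
  have inner_lim: "(\<lambda>n. \<integral>y. L_fun \<tau> (circ (Y_seq n x)) (circ (Y_seq n y)) \<partial>\<Omega>)
      \<longlonglongrightarrow> (\<integral>y. L_fun \<tau> (circ (Y x)) (circ (Y y)) \<partial>\<Omega>)" if "x \<in> space \<Omega>" for x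
    by (rule integral_dominated_convergence[where w = "\<lambda>_. L_bound \<tau>"])
       (use that L_lim L_fun_le in \<open>auto simp del: mem_sphere_0\<close>)
  have outer_lim: "(\<lambda>n. \<integral>x. \<integral>y. L_fun \<tau> (circ (Y_seq n x)) (circ (Y_seq n y)) \<partial>\<Omega> \<partial>\<Omega>)
      \<longlonglongrightarrow> (\<integral>x. \<integral>y. L_fun \<tau> (circ (Y x)) (circ (Y y)) \<partial>\<Omega> \<partial>\<Omega>)"
  proof (rule integral_dominated_convergence[where w = "\<lambda>_. L_bound \<tau>"])
    show "AE x in \<Omega>. norm (\<integral>y. L_fun \<tau> (circ (Y_seq n x)) (circ (Y_seq n y)) \<partial>\<Omega>) \<le> L_bound \<tau>" for n
    proof (rule AE_I2)
      fix x
      have "(\<integral>y. L_fun \<tau> (circ (Y_seq n x)) (circ (Y_seq n y)) \<partial>\<Omega>) \<le> (\<integral>y. L_bound \<tau> \<partial>\<Omega>)"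
        using L_fun_le by (intro integral_mono \<Omega>.integrable_const_bound[where B = "L_bound \<tau>"])
           (auto simp del: mem_sphere_0)
      then show "norm (\<integral>y. L_fun \<tau> (circ (Y_seq n x)) (circ (Y_seq n y)) \<partial>\<Omega>) \<le> L_bound \<tau>"
        by (simp add: \<Omega>.prob_space)
    qed
  qed (use inner_lim in auto)
  have act_n: "action \<tau> (\<rho> (r n)) = (\<integral>x. \<integral>y. L_fun \<tau> (circ (Y_seq n x)) (circ (Y_seq n y)) \<partial>\<Omega> \<partial>\<Omega>)" for n
  proof -
    interpret circle_measure "\<rho> (r n)" by (rule \<rho>)
    interpret P: prob_space "\<mu> (r n)" using rd real_distribution.axioms by blast
    \<comment> \<open>\<open>circ\<close> undoes \<open>angle_of\<close> on the circle, so wrapping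
      the angles back recovers the measure itself, and its action is that of the law of
      \<open>circ\<close> applied to the random angle.\<close>
    have eq: "\<rho> (r n) = distr (\<mu> (r n)) (restrict_space borel S1) circ"
    proof -
      have "circ \<in> measurable borel (restrict_space borel S1)"
        by (intro measurable_restrict_space2) auto
      then have "distr (\<mu> (r n)) (restrict_space borel S1) circ
          = distr (\<rho> (r n)) (restrict_space borel S1) (circ \<circ> angle_of)"
        unfolding \<mu>_def using ang by (intro distr_distr) auto
      also have "\<dots> = distr (\<rho> (r n)) (restrict_space borel S1) (\<lambda>x. x)"
        by (rule distr_cong) (auto simp: circ_angle_of)
      also have "\<dots> = \<rho> (r n)"
        by (rule distr_id2) (simp add: sets_rho)
      finally show ?thesis by simp
    qed
    also have "\<dots> = distr \<Omega> (restrict_space borel S1) (circ \<circ> Y_seq n)"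
      unfolding dYn[symmetric]
      by (intro distr_distr) (auto intro: measurable_restrict_space2)
    finally have "action \<tau> (\<rho> (r n)) = action \<tau> (distr \<Omega> (restrict_space borel S1) (circ \<circ> Y_seq n))"
      by simp
    then show ?thesis by (simp add: action_distr_circle[OF \<Omega>])
  qed
  define \<nu> where "\<nu> = distr \<Omega> (restrict_space borel S1) (\<lambda>x. circ (Y x))"
  have \<nu>: "circle_measure \<nu>" unfolding \<nu>_def by (intro circle_measure_distr \<Omega>) auto
  have "(\<lambda>n. action \<tau> (\<rho> (r n))) \<longlonglongrightarrow> action \<tau> \<nu>"
    using outer_lim unfolding \<nu>_def act_n by (subst action_distr_circle[OF \<Omega>]) auto
  moreover have "(\<lambda>n. min_action \<tau> + 1 / real (Suc (r n))) \<longlonglongrightarrow> min_action \<tau> + 0"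
    using LIMSEQ_subseq_LIMSEQ[OF LIMSEQ_inverse_real_of_nat r]
    by (intro tendsto_intros) (simp add: o_def divide_inverse)
  ultimately have "action \<tau> \<nu> \<le> min_action \<tau>"
    using act by (intro LIMSEQ_le[of _ "action \<tau> \<nu>" _ "min_action \<tau>"]) (auto intro: less_imp_le)
  with min_action_le[OF \<nu>, of \<tau>] \<nu> have "minimizer \<tau> \<nu>"
    by (auto simp: minimizer_def circle_measure_iff)
  then show ?thesis ..
qed

section \<open>First and second variations of the action\<close>

context circle_measure
begin

lemma support_iff:
  "x \<in> measure_support \<rho> \<longleftrightarrow>
     x \<in> S1 \<and> (\<forall>U. openin (top_of_set S1) U \<longrightarrow> x \<in> U \<longrightarrow> emeasure \<rho> U \<noteq> 0)"
  by (auto simp: measure_support_def)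

lemma support_subset: "measure_support \<rho> \<subseteq> S1"
  by (auto simp: measure_support_def)

lemma openin_support_pos:
  assumes "x \<in> measure_support \<rho>" "openin (top_of_set S1) U" "x \<in> U"
  shows "0 < prob U"
  using assms by (auto simp: support_iff emeasure_eq_measure zero_less_measure_iff)

lemma closed_support: "closed (measure_support \<rho>)"
proof -
  have "closedin (top_of_set S1) (measure_support \<rho>)"
    unfolding measure_support_def
    by (rule closedin_diff) (auto intro: openin_Union)
  then show ?thesis by (rule closedin_closed_trans) simp
qed

text \<open>There may be uncountably many open null sets; the Lindelof property replaces them by
  countably many with the same union.\<close>

lemma AE_support: "AE x in \<rho>. x \<in> measure_support \<rho>"
proof -
  let ?F = "{U. openin (top_of_set S1) U \<and> emeasure \<rho> U = 0}"
  obtain F' where F': "F' \<subseteq> ?F" "countable F'" "\<Union>F' = \<Union>?F"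
    using Lindelof_openin[of ?F S1] by auto
  have "(\<Union>U\<in>F'. U) \<in> null_sets \<rho>"
  proof (rule null_sets_UN'[OF F'(2)])
    fix U assume "U \<in> F'"
    then have "U \<in> ?F" using F'(1) by (rule rev_subsetD)
    then show "U \<in> null_sets \<rho>" using openin_sets by (simp add: null_sets_def)
  qed
  then have "\<Union>?F \<in> null_sets \<rho>" using F'(3) by simp
  from AE_not_in[OF this] have "AE x in \<rho>. x \<notin> \<Union>?F" .
  moreover have "AE x in \<rho>. x \<in> S1" by (rule AE_I2) simp
  ultimately show ?thesis unfolding measure_support_def by eventually_elim (rule DiffI)
qed

lemma support_nonempty: "measure_support \<rho> \<noteq> {}"
proof
  assume "measure_support \<rho> = {}"
  then have "AE x in \<rho>. False" using AE_support by simp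
  then show False using AE_False by blast
qed

text \<open>A class of test functions closed under sums, products and integration against the
  kernel, so that the integrability conditions below follow from the shape of the terms.\<close>

definition bdd_meas :: "(plane \<Rightarrow> real) \<Rightarrow> bool" where
  "bdd_meas f \<longleftrightarrow> f \<in> borel_measurable \<rho> \<and> (\<exists>B. \<forall>x\<in>S1. \<bar>f x\<bar> \<le> B)"

lemma bdd_measI: "f \<in> borel_measurable \<rho> \<Longrightarrow> (\<And>x. x \<in> S1 \<Longrightarrow> \<bar>f x\<bar> \<le> B) \<Longrightarrow> bdd_meas f"
  unfolding bdd_meas_def by (intro conjI exI[of _ B] ballI)

lemma bdd_measE:
  assumes "bdd_meas f" obtains B where "0 \<le> B" "\<And>x. x \<in> S1 \<Longrightarrow> \<bar>f x\<bar> \<le> B"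
proof -
  obtain B where B: "\<forall>x\<in>S1. \<bar>f x\<bar> \<le> B" using assms unfolding bdd_meas_def by (elim conjE exE)
  have "0 \<le> B" using bspec[OF B circ_in_S1, of 0] by simp
  then show ?thesis using bspec[OF B] by (rule that)
qed

lemma bdd_meas_measurable: "bdd_meas f \<Longrightarrow> f \<in> borel_measurable \<rho>"
  by (simp add: bdd_meas_def)

lemma bdd_meas_integrable: "bdd_meas f \<Longrightarrow> integrable \<rho> f"
  by (auto simp: bdd_meas_def intro: integrable_bounded)

lemma bdd_meas_const [simp]: "bdd_meas (\<lambda>_. c)"
  by (rule bdd_measI[of _ "\<bar>c\<bar>"]) auto

lemma bdd_meas_add: "bdd_meas f \<Longrightarrow> bdd_meas h \<Longrightarrow> bdd_meas (\<lambda>x. f x + h x)"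
proof -
  assume f: "bdd_meas f" and h: "bdd_meas h"
  obtain B where B: "0 \<le> B" "\<And>x. x \<in> S1 \<Longrightarrow> \<bar>f x\<bar> \<le> B" using f by (rule bdd_measE) blast
  obtain C where C: "0 \<le> C" "\<And>x. x \<in> S1 \<Longrightarrow> \<bar>h x\<bar> \<le> C" using h by (rule bdd_measE) blast
  have "\<bar>f x + h x\<bar> \<le> B + C" if "x \<in> S1" for x using B(2)[OF that] C(2)[OF that] by linarith
  with bdd_meas_measurable[OF f] bdd_meas_measurable[OF h] show ?thesis
    by (intro bdd_measI borel_measurable_add)
qed

lemma bdd_meas_mult: "bdd_meas f \<Longrightarrow> bdd_meas h \<Longrightarrow> bdd_meas (\<lambda>x. f x * h x)"
proof -
  assume f: "bdd_meas f" and h: "bdd_meas h"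
  obtain B where B: "0 \<le> B" "\<And>x. x \<in> S1 \<Longrightarrow> \<bar>f x\<bar> \<le> B" using f by (rule bdd_measE) blast
  obtain C where C: "0 \<le> C" "\<And>x. x \<in> S1 \<Longrightarrow> \<bar>h x\<bar> \<le> C" using h by (rule bdd_measE) blast
  have "\<bar>f x * h x\<bar> \<le> B * C" if "x \<in> S1" for x
    unfolding abs_mult using B(1) B(2)[OF that] C(2)[OF that] by (intro mult_mono) auto
  with bdd_meas_measurable[OF f] bdd_meas_measurable[OF h] show ?thesis
    by (intro bdd_measI borel_measurable_times)
qed

lemma bdd_meas_sum:
  "(\<And>i. i \<in> I \<Longrightarrow> bdd_meas (f i)) \<Longrightarrow> bdd_meas (\<lambda>x. \<Sum>i\<in>I. f i x)"
  by (induction I rule: infinite_finite_induct) (auto intro: bdd_meas_add)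

lemma bdd_meas_indicator: "U \<in> sets \<rho> \<Longrightarrow> bdd_meas (indicator U)"
  by (rule bdd_measI[of _ 1]) (auto simp: indicator_def)

lemma bdd_meas_L: "x \<in> S1 \<Longrightarrow> bdd_meas (\<lambda>y. L_fun \<tau> x y)"
  by (rule bdd_measI[OF _ abs_L_fun]) auto

lemma bdd_meas_smear: "bdd_meas h \<Longrightarrow> bdd_meas (\<lambda>x. \<integral>y. h y * L_fun \<tau> x y \<partial>\<rho>)"
proof -
  assume h: "bdd_meas h"
  note [measurable] = bdd_meas_measurable[OF h]
  obtain C where C0: "0 \<le> C" and C: "\<And>x. x \<in> S1 \<Longrightarrow> \<bar>h x\<bar> \<le> C" using h by (rule bdd_measE) blast
  have "\<bar>\<integral>y. h y * L_fun \<tau> x y \<partial>\<rho>\<bar> \<le> C * L_bound \<tau>" if "x \<in> S1" for x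
  proof (rule integral_bounded)
    show "\<bar>h y * L_fun \<tau> x y\<bar> \<le> C * L_bound \<tau>" if "y \<in> S1" for y
      unfolding abs_mult using C0 C[OF that] abs_L_fun[OF \<open>x \<in> S1\<close> that] by (intro mult_mono) auto
  qed measurable
  moreover have "(\<lambda>x. \<integral>y. h y * L_fun \<tau> x y \<partial>\<rho>) \<in> borel_measurable \<rho>" by measurable
  ultimately show ?thesis by (intro bdd_measI)
qed

text \<open>The bilinear form of the kernel as an integral operator on L^2(\<rho>); f and h stand
  for the signed measures with these densities.\<close>

definition form :: "real \<Rightarrow> (plane \<Rightarrow> real) \<Rightarrow> (plane \<Rightarrow> real) \<Rightarrow> real" where
  "form \<tau> f h = (\<integral>x. f x * (\<integral>y. h y * L_fun \<tau> x y \<partial>\<rho>) \<partial>\<rho>)"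

lemma form_sum_left:
  assumes "\<And>i. i \<in> I \<Longrightarrow> bdd_meas (f i)" "bdd_meas h"
  shows "form \<tau> (\<lambda>x. \<Sum>i\<in>I. f i x) h = (\<Sum>i\<in>I. form \<tau> (f i) h)"
  unfolding form_def sum_distrib_right using assms
  by (intro Bochner_Integration.integral_sum bdd_meas_integrable bdd_meas_mult bdd_meas_smear) auto

lemma form_add_left:
  assumes "bdd_meas f" "bdd_meas g" "bdd_meas h"
  shows "form \<tau> (\<lambda>x. f x + g x) h = form \<tau> f h + form \<tau> g h"
  unfolding form_def distrib_right using assms
  by (intro Bochner_Integration.integral_add bdd_meas_integrable bdd_meas_mult bdd_meas_smear) auto

lemma form_scale_left: "form \<tau> (\<lambda>x. c * f x) h = c * form \<tau> f h"
  by (simp add: form_def mult.assoc)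

lemma form_commute:
  assumes "bdd_meas f" "bdd_meas h"
  shows "form \<tau> f h = form \<tau> h f"
proof -
  interpret P: pair_prob_space \<rho> \<rho> by unfold_locales
  note [measurable] = bdd_meas_measurable[OF assms(1)] bdd_meas_measurable[OF assms(2)]
  obtain B where B0: "0 \<le> B" and B: "\<And>x. x \<in> S1 \<Longrightarrow> \<bar>f x\<bar> \<le> B"
    using assms(1) by (rule bdd_measE) blast
  obtain C where C0: "0 \<le> C" and C: "\<And>x. x \<in> S1 \<Longrightarrow> \<bar>h x\<bar> \<le> C"
    using assms(2) by (rule bdd_measE) blast
  have "integrable (\<rho> \<Otimes>\<^sub>M \<rho>) (\<lambda>(x, y). f x * (h y * L_fun \<tau> x y))"
  proof (rule P.P.integrable_const_bound[where B = "B * (C * L_bound \<tau>)"])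
    show "AE p in \<rho> \<Otimes>\<^sub>M \<rho>. norm (case p of (x, y) \<Rightarrow> f x * (h y * L_fun \<tau> x y)) \<le> B * (C * L_bound \<tau>)"
    proof (rule AE_I2)
      fix p assume "p \<in> space (\<rho> \<Otimes>\<^sub>M \<rho>)"
      then obtain x y where p: "p = (x, y)" "x \<in> S1" "y \<in> S1" by (auto simp: space_pair_measure)
      have "\<bar>f x\<bar> * (\<bar>h y\<bar> * \<bar>L_fun \<tau> x y\<bar>) \<le> B * (C * L_bound \<tau>)"
        using B0 C0 B[OF p(2)] C[OF p(3)] abs_L_fun[OF p(2,3)]
        by (intro mult_mono mult_nonneg_nonneg) auto
      then show "norm (case p of (x, y) \<Rightarrow> f x * (h y * L_fun \<tau> x y)) \<le> B * (C * L_bound \<tau>)"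
        by (simp add: p(1) abs_mult)
    qed
  qed measurable
  then have "(\<integral>y. \<integral>x. f x * (h y * L_fun \<tau> x y) \<partial>\<rho> \<partial>\<rho>) = (\<integral>x. \<integral>y. f x * (h y * L_fun \<tau> x y) \<partial>\<rho> \<partial>\<rho>)"
    by (rule P.Fubini_integral)
  moreover have "form \<tau> f h = (\<integral>x. \<integral>y. f x * (h y * L_fun \<tau> x y) \<partial>\<rho> \<partial>\<rho>)"
    by (simp add: form_def)
  moreover have "form \<tau> h f = (\<integral>y. \<integral>x. h y * (f x * L_fun \<tau> y x) \<partial>\<rho> \<partial>\<rho>)"
    by (simp add: form_def)
  ultimately show ?thesis by (simp add: mult.left_commute L_fun_commute)
qed

lemma indicator_mult_mono: "(x \<in> A \<Longrightarrow> a \<le> b) \<Longrightarrow> indicator A x * a \<le> indicator A x * (b :: real)"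
  by (simp add: indicator_def)

text \<open>Meant for small neighbourhoods of two support points, on which the kernel is almost
  constant: the form of the indicators is then nearly the product of the masses and the kernel
  value.\<close>

lemma form_bounds:
  assumes U: "U \<in> sets \<rho>" and V: "V \<in> sets \<rho>"
    and L: "\<And>x y. x \<in> U \<Longrightarrow> y \<in> V \<Longrightarrow> \<bar>L_fun \<tau> x y - l\<bar> \<le> \<eta>"
  shows "\<bar>form \<tau> (indicator U) (indicator V) - prob U * prob V * l\<bar> \<le> prob U * prob V * \<eta>"
proof -
  have US: "U \<subseteq> S1" "V \<subseteq> S1" using U V by (auto simp: in_sets)
  have i: "integrable \<rho> (\<lambda>y. indicator V y * L_fun \<tau> x y)" if "x \<in> S1" for x
    using that V by (intro bdd_meas_integrable bdd_meas_mult bdd_meas_indicator bdd_meas_L)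
  have j: "integrable \<rho> (\<lambda>x. indicator U x * (\<integral>y. indicator V y * L_fun \<tau> x y \<partial>\<rho>))"
    using U V by (intro bdd_meas_integrable bdd_meas_mult bdd_meas_indicator bdd_meas_smear)
  have inner: "prob V * (l - \<eta>) \<le> (\<integral>y. indicator V y * L_fun \<tau> x y \<partial>\<rho>)"
       "(\<integral>y. indicator V y * L_fun \<tau> x y \<partial>\<rho>) \<le> prob V * (l + \<eta>)" if x: "x \<in> U" for x
  proof -
    have xS: "x \<in> S1" using US x by auto
    have c: "(\<integral>y. indicator V y * c \<partial>\<rho>) = prob V * c" for c :: real using V US by (simp add: Int_absorb2)
    have k: "integrable \<rho> (\<lambda>y. indicator V y * c)" for c :: real
      using V by (intro bdd_meas_integrable bdd_meas_mult bdd_meas_indicator bdd_meas_const)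
    have b: "l - \<eta> \<le> L_fun \<tau> x y" "L_fun \<tau> x y \<le> l + \<eta>" if "y \<in> V" for y
      using L[OF x that] by (auto simp: abs_le_iff)
    show "prob V * (l - \<eta>) \<le> (\<integral>y. indicator V y * L_fun \<tau> x y \<partial>\<rho>)"
      unfolding c[symmetric] by (intro integral_mono k i xS indicator_mult_mono b)
    show "(\<integral>y. indicator V y * L_fun \<tau> x y \<partial>\<rho>) \<le> prob V * (l + \<eta>)"
      unfolding c[symmetric] by (intro integral_mono k i xS indicator_mult_mono b)
  qed
  have c: "(\<integral>x. indicator U x * c \<partial>\<rho>) = prob U * c" for c :: real using U US by (simp add: Int_absorb2)
  have k: "integrable \<rho> (\<lambda>y. indicator U y * c)" for c :: real
    using U by (intro bdd_meas_integrable bdd_meas_mult bdd_meas_indicator bdd_meas_const)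
  have "prob U * (prob V * (l - \<eta>)) \<le> form \<tau> (indicator U) (indicator V)"
    unfolding c[symmetric] form_def by (intro integral_mono k j indicator_mult_mono inner)
  moreover have "form \<tau> (indicator U) (indicator V) \<le> prob U * (prob V * (l + \<eta>))"
    unfolding c[symmetric] form_def by (intro integral_mono k j indicator_mult_mono inner)
  ultimately show ?thesis by (auto simp: abs_le_iff algebra_simps)
qed

text \<open>Minimality in homogeneous form: g divided by its mass is the density of a competitor,
  and the form is quadratic in g.\<close>

lemma min_action_density:
  assumes g: "bdd_meas g" "\<And>x. 0 \<le> g x" and pos: "0 < (\<integral>x. g x \<partial>\<rho>)"
  shows "min_action \<tau> * (\<integral>x. g x \<partial>\<rho>)\<^sup>2 \<le> form \<tau> g g"
proof -
  define M where "M = (\<integral>x. g x \<partial>\<rho>)"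
  define N where "N = density \<rho> (\<lambda>x. ennreal (g x / M))"
  have M: "0 < M" using pos by (simp add: M_def)
  note [measurable] = bdd_meas_measurable[OF g(1)]
  have "prob_space N"
  proof
    have "emeasure N (space N) = (\<integral>\<^sup>+x. ennreal (g x / M) \<partial>\<rho>)"
      unfolding N_def by (subst emeasure_density) (auto simp: sets.top simp flip: space_rho intro!: nn_integral_cong)
    also have "\<dots> = ennreal (\<integral>x. g x / M \<partial>\<rho>)"
      using g M by (intro nn_integral_eq_integral integrable_divide_zero) (auto simp: bdd_meas_integrable)
    also have "\<dots> = 1" using M by (simp add: M_def[symmetric])
    finally show "emeasure N (space N) = 1" .
  qed
  then have N: "circle_measure N"
    by (simp add: circle_measure_def circle_measure_axioms_def N_def sets_rho)
  have dens: "(\<integral>x. f x \<partial>N) = (\<integral>x. g x / M * f x \<partial>\<rho>)" if "f \<in> borel_measurable \<rho>" for f :: "plane \<Rightarrow> real"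
    unfolding N_def using g M that by (subst integral_density) auto
  have "action \<tau> N = (\<integral>x. \<integral>y. g y / M * L_fun \<tau> x y \<partial>\<rho> \<partial>N)"
    unfolding action_def by (subst dens) auto
  also have "\<dots> = (\<integral>x. g x / M * (\<integral>y. g y / M * L_fun \<tau> x y \<partial>\<rho>) \<partial>\<rho>)"
    by (rule dens) measurable
  also have "\<dots> = form \<tau> g g / M\<^sup>2"
    using M by (simp add: form_def power2_eq_square)
  finally show ?thesis
    using mult_right_mono[OF min_action_le[OF N, of \<tau>], of "M\<^sup>2"] M by (simp add: M_def[symmetric])
qed

text \<open>The convex combination of \<rho> with the point mass at z, obtained as the law of a coin
  toss between z and a sample of \<rho>. Densities cannot produce it, since \<rho> may give no mass
  to z.\<close>

lemma mixture_exists: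
  assumes z: "z \<in> S1" and \<epsilon>: "0 \<le> \<epsilon>" "\<epsilon> \<le> 1"
  obtains N where "circle_measure N"
    and "\<And>f. bdd_meas f \<Longrightarrow> (\<integral>x. f x \<partial>N) = \<epsilon> * f z + (1 - \<epsilon>) * (\<integral>x. f x \<partial>\<rho>)"
proof -
  let ?B = "measure_pmf (bernoulli_pmf \<epsilon>)"
  let ?P = "?B \<Otimes>\<^sub>M \<rho>"
  let ?T = "\<lambda>p. if fst p then z else snd p"
  interpret B: prob_space ?B by (rule prob_space_measure_pmf)
  interpret P: pair_prob_space ?B \<rho> by unfold_locales
  have Tm [measurable]: "?T \<in> borel_measurable ?P" by measurable
  have TS: "x \<in> space ?P \<Longrightarrow> ?T x \<in> S1" for x
    using z by (auto simp: space_pair_measure simp del: mem_sphere_0)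
  define N where "N = distr ?P (restrict_space borel S1) ?T"
  have "circle_measure N" unfolding N_def by (rule circle_measure_distr[OF P.P.prob_space_axioms Tm TS])
  moreover have "(\<integral>x. f x \<partial>N) = \<epsilon> * f z + (1 - \<epsilon>) * (\<integral>x. f x \<partial>\<rho>)" if f: "bdd_meas f" for f
  proof -
    obtain C where C: "\<And>x. x \<in> S1 \<Longrightarrow> \<bar>f x\<bar> \<le> C" using f by (rule bdd_measE) blast
    have fm: "f \<in> borel_measurable (restrict_space borel S1)"
      using bdd_meas_measurable[OF f] by (simp add: measurable_cong_sets[OF sets_rho refl])
    have cm: "(\<lambda>p. f (?T p)) \<in> borel_measurable ?P"
      using measurable_compose[OF circle_measure_distr(2)[OF P.P.prob_space_axioms Tm TS] fm] .
    have "(\<integral>x. f x \<partial>N) = (\<integral>p. f (?T p) \<partial>?P)"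
      unfolding N_def by (rule integral_distr_circle[OF P.P.prob_space_axioms Tm TS fm])
    also have "\<dots> = (\<integral>b. \<integral>x. f (?T (b, x)) \<partial>\<rho> \<partial>?B)"
    proof (rule P.integral_fst'[symmetric])
      show "integrable ?P (\<lambda>p. f (?T p))"
        by (rule P.P.integrable_const_bound[where B = C]) (use C TS cm in auto)
    qed
    also have "\<dots> = \<epsilon> * f z + (1 - \<epsilon>) * (\<integral>x. f x \<partial>\<rho>)"
      using \<epsilon> prob_space by (subst integral_bernoulli_pmf) auto
    finally show ?thesis .
  qed
  ultimately show ?thesis by (rule that)
qed

end

section \<open>Euler-Lagrange conditions and the second variation\<close>

locale circle_minimizer = circle_measure \<rho> for \<rho> +
  fixes \<tau> :: real
  assumes minimal: "action \<tau> \<rho> = min_action \<tau>"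
begin

abbreviation S :: real where "S \<equiv> min_action \<tau>"
abbreviation \<phi> :: "plane \<Rightarrow> real" where "\<phi> \<equiv> potential \<tau>"

lemma S_nonneg: "0 \<le> S"
  unfolding minimal[symmetric] by (rule action_nonneg)

text \<open>The first variation towards the point mass at z: the action has derivative 2 (\<phi> z -
  S) at \<epsilon> = 0, which minimality forbids to be negative.\<close>

lemma potential_ge: assumes z: "z \<in> S1" shows "S \<le> \<phi> z"
proof (rule ccontr)
  assume "\<not> S \<le> \<phi> z"
  then have d: "0 < S - \<phi> z" by simp
  \<comment> \<open>A bound for the coefficient of \<epsilon>^2 in the action of the mixture; the
    added 1 makes it positive.\<close>
  define C where "C = \<bar>S - 2 * \<phi> z + L_fun \<tau> z z\<bar> + 1"
  define \<epsilon> where "\<epsilon> = min (1/2) ((S - \<phi> z) / C)"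
  have C: "0 < C" by (simp add: C_def)
  have \<epsilon>: "0 < \<epsilon>" "\<epsilon> \<le> 1" "\<epsilon> * C \<le> S - \<phi> z"
    using d C by (auto simp: \<epsilon>_def min_def field_simps)
  obtain N where N: "circle_measure N"
    and int: "\<And>f. bdd_meas f \<Longrightarrow> (\<integral>x. f x \<partial>N) = \<epsilon> * f z + (1 - \<epsilon>) * (\<integral>x. f x \<partial>\<rho>)"
    using mixture_exists[OF z, of \<epsilon>] \<epsilon> by auto
  interpret N: circle_measure N by fact
  have bp: "bdd_meas \<phi>" by (rule bdd_measI[OF potential_measurable potential_bounded])
  have bz: "bdd_meas (\<lambda>x. L_fun \<tau> x z)" using bdd_meas_L[OF z, of \<tau>] by (simp add: L_fun_commute)
  have "action \<tau> N = (\<integral>x. \<epsilon> * L_fun \<tau> x z + (1 - \<epsilon>) * \<phi> x \<partial>N)"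
    unfolding action_def
  proof (rule Bochner_Integration.integral_cong[OF refl])
    fix x assume "x \<in> space N"
    then have "x \<in> S1" by simp
    then show "(\<integral>y. L_fun \<tau> x y \<partial>N) = \<epsilon> * L_fun \<tau> x z + (1 - \<epsilon>) * \<phi> x"
      by (subst int[OF bdd_meas_L]) (simp_all add: potential_def)
  qed
  also have "\<dots> = \<epsilon> * (\<epsilon> * L_fun \<tau> z z + (1 - \<epsilon>) * \<phi> z)
      + (1 - \<epsilon>) * (\<integral>x. \<epsilon> * L_fun \<tau> x z + (1 - \<epsilon>) * \<phi> x \<partial>\<rho>)"
    by (rule int) (intro bdd_meas_add bdd_meas_mult bdd_meas_const bp bz)
  also have "(\<integral>x. \<epsilon> * L_fun \<tau> x z + (1 - \<epsilon>) * \<phi> x \<partial>\<rho>) = \<epsilon> * \<phi> z + (1 - \<epsilon>) * S"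
  proof -
    have "(\<integral>x. \<epsilon> * L_fun \<tau> x z + (1 - \<epsilon>) * \<phi> x \<partial>\<rho>) = \<epsilon> * (\<integral>x. L_fun \<tau> x z \<partial>\<rho>) + (1 - \<epsilon>) * (\<integral>x. \<phi> x \<partial>\<rho>)"
      using bdd_meas_integrable[OF bp] bdd_meas_integrable[OF bz] by simp
    then show ?thesis
      by (simp add: action_potential[symmetric] minimal L_fun_commute[of \<tau> _ z] potential_def[symmetric])
  qed
  finally have "S \<le> \<epsilon> * (\<epsilon> * L_fun \<tau> z z + (1 - \<epsilon>) * \<phi> z) + (1 - \<epsilon>) * (\<epsilon> * \<phi> z + (1 - \<epsilon>) * S)"
    using min_action_le[OF N, of \<tau>] by simp
  then have "\<epsilon> * (2 * (S - \<phi> z)) \<le> \<epsilon> * (\<epsilon> * (S - 2 * \<phi> z + L_fun \<tau> z z))"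
    by (simp add: algebra_simps)
  then have "2 * (S - \<phi> z) \<le> \<epsilon> * (S - 2 * \<phi> z + L_fun \<tau> z z)" using \<epsilon> by simp
  also have "\<dots> \<le> \<epsilon> * C" using \<epsilon> by (intro mult_left_mono) (auto simp: C_def)
  finally show False using \<epsilon> d by simp
qed

text \<open>\<phi> - S is nonnegative, and its integral is the action minus S, which is 0.\<close>

lemma AE_potential: "AE x in \<rho>. \<phi> x = S"
proof -
  have i: "integrable \<rho> \<phi>" by (rule integrable_bounded[OF potential_measurable potential_bounded])
  have "(\<integral>x. \<phi> x - S \<partial>\<rho>) = 0"
    using i prob_space by (simp add: action_potential[symmetric] minimal)
  then have "AE x in \<rho>. \<phi> x - S = 0"
    using i potential_ge by (subst integral_nonneg_eq_0_iff_AE[symmetric]) auto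
  then show ?thesis by simp
qed

text \<open>By continuity, the set where \<phi> differs from S is open; as it is null, it misses the
  support.\<close>

lemma potential_eq: assumes x: "x \<in> measure_support \<rho>" shows "\<phi> x = S"
proof (rule ccontr)
  assume ne: "\<phi> x \<noteq> S"
  let ?U = "S1 \<inter> \<phi> -` (- {S})"
  have op: "openin (top_of_set S1) ?U"
    by (rule continuous_openin_preimage_gen[OF continuous_on_potential]) auto
  have "AE y in \<rho>. y \<notin> ?U" using AE_potential by (rule AE_mp) simp
  then have "emeasure \<rho> ?U = 0"
    using AE_iff_null_sets[OF openin_sets[OF op]] by auto
  moreover have "x \<in> ?U" using x ne support_subset by auto
  ultimately show False using x op by (auto simp: support_iff)
qed

text \<open>Perturb \<open>\<rho>\<close> by the density \<open>1 + \<delta> \<psi>\<close>: as the potential is constant almost everywhere, only the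
  quadratic term is left after normalization.\<close>

lemma form_nonneg:
  assumes \<psi>: "bdd_meas \<psi>" shows "0 \<le> form \<tau> \<psi> \<psi>"
proof -
  obtain C where C0: "0 \<le> C" and C: "\<And>x. x \<in> S1 \<Longrightarrow> \<bar>\<psi> x\<bar> \<le> C"
    using \<psi> by (rule bdd_measE) blast
  \<comment> \<open>Scaled so that the perturbation is at most 1/2 in absolute value: the density 1
    + \<psi>' stays nonnegative and its mass positive.\<close>
  define \<delta> where "\<delta> = 1 / (2 * (C + 1))"
  have \<delta>: "0 < \<delta>" "\<delta> * C \<le> 1/2" using C0 by (auto simp: \<delta>_def field_simps)
  \<comment> \<open>The cut-off changes no integral over the circle, but it extends the bound to the
    whole plane, where \<open>min_action_density\<close> asks for nonnegativity.\<close>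
  define \<psi>' where "\<psi>' x = \<delta> * (\<psi> x * indicator S1 x)" for x
  have \<psi>'_S1: "\<psi>' x = \<delta> * \<psi> x" if "x \<in> S1" for x using that by (simp add: \<psi>'_def)
  have "S1 \<in> sets \<rho>" by (simp add: in_sets)
  then have b: "bdd_meas \<psi>'" unfolding \<psi>'_def
    by (intro bdd_meas_mult \<psi> bdd_meas_const bdd_meas_indicator)
  have small: "\<bar>\<psi>' x\<bar> \<le> 1/2" for x
  proof (cases "x \<in> S1")
    case True
    have "\<delta> * \<bar>\<psi> x\<bar> \<le> \<delta> * C" using \<delta> C[OF True] by (intro mult_left_mono) auto
    then have "\<delta> * \<bar>\<psi> x\<bar> \<le> 1/2" using \<delta> by linarith
    then show ?thesis using \<delta>(1) unfolding \<psi>'_S1[OF True] by (simp add: abs_mult)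
  qed (simp add: \<psi>'_def)
  define m where "m = (\<integral>x. \<psi>' x \<partial>\<rho>)"
  have im: "(\<integral>x. 1 + \<psi>' x \<partial>\<rho>) = 1 + m"
    using bdd_meas_integrable[OF b] prob_space by (simp add: m_def)
  have "\<bar>m\<bar> \<le> 1/2" unfolding m_def using bdd_meas_measurable[OF b] small by (intro integral_bounded) auto
  then have pos: "0 < 1 + m" by linarith
  have f11: "form \<tau> (\<lambda>_. 1) (\<lambda>_. 1) = S"
    by (simp add: form_def potential_def[symmetric] action_potential[symmetric] minimal)
  have f\<psi>1: "form \<tau> \<psi>' (\<lambda>_. 1) = S * m"
  proof -
    have "form \<tau> \<psi>' (\<lambda>_. 1) = (\<integral>x. \<psi>' x * \<phi> x \<partial>\<rho>)" by (simp add: form_def potential_def)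
    also have "\<dots> = (\<integral>x. \<psi>' x * S \<partial>\<rho>)"
      using bdd_meas_measurable[OF b] AE_potential by (intro integral_cong_AE) auto
    finally show ?thesis by (simp add: m_def)
  qed
  let ?g = "\<lambda>x. 1 + \<psi>' x"
  have bg: "bdd_meas ?g" by (intro bdd_meas_add bdd_meas_const b)
  have g0: "0 \<le> ?g x" for x using small[of x] by (simp add: abs_le_iff)
  have "form \<tau> ?g ?g = form \<tau> (\<lambda>_. 1) ?g + form \<tau> \<psi>' ?g"
    by (rule form_add_left) (auto intro: b bg)
  also have "form \<tau> (\<lambda>_. 1) ?g = form \<tau> (\<lambda>_. 1) (\<lambda>_. 1) + form \<tau> \<psi>' (\<lambda>_. 1)"
    by (subst form_commute) (auto intro!: form_add_left b bg)
  also have "form \<tau> \<psi>' ?g = form \<tau> \<psi>' (\<lambda>_. 1) + form \<tau> \<psi>' \<psi>'"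
    by (subst form_commute, (auto intro: b bg)[2], subst form_add_left)
       (auto intro: b bg simp: form_commute[OF bdd_meas_const b])
  finally have "form \<tau> ?g ?g = S + 2 * S * m + form \<tau> \<psi>' \<psi>'"
    by (simp add: f11 f\<psi>1)
  moreover have "S * (1 + m)\<^sup>2 \<le> form \<tau> ?g ?g"
    using min_action_density[OF bg g0, of \<tau>] pos by (simp add: im)
  ultimately have "S * m\<^sup>2 \<le> form \<tau> \<psi>' \<psi>'"
    by (simp add: power2_eq_square algebra_simps)
  then have "0 \<le> form \<tau> \<psi>' \<psi>'" using S_nonneg by (meson mult_nonneg_nonneg order_trans zero_le_power2)
  moreover have "form \<tau> \<psi>' \<psi>' = \<delta> * (\<delta> * form \<tau> \<psi> \<psi>)"
  proof -
    have "form \<tau> \<psi>' \<psi>' = (\<integral>x. \<delta> * \<psi> x * (\<integral>y. \<delta> * \<psi> y * L_fun \<tau> x y \<partial>\<rho>) \<partial>\<rho>)"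
      unfolding form_def by (intro Bochner_Integration.integral_cong refl arg_cong2[where f = "(*)"])
        (simp_all add: \<psi>'_S1 del: mem_sphere_0)
    also have "\<dots> = (\<integral>x. \<delta> * (\<delta> * (\<psi> x * (\<integral>y. \<psi> y * L_fun \<tau> x y \<partial>\<rho>))) \<partial>\<rho>)"
      by (rule Bochner_Integration.integral_cong[OF refl]) (simp add: mult.assoc)
    finally show ?thesis by (simp add: form_def)
  qed
  ultimately show ?thesis using \<delta> by (simp add: zero_le_mult_iff)
qed

text \<open>Point masses are not densities, so each is approximated by the normalized indicator of a
  small ball, whose mass is positive because its centre lies in the support. The Lipschitz bound
  controls the error.\<close>

lemma support_gram_nonneg:
  fixes x :: "'i \<Rightarrow> plane" and a :: "'i \<Rightarrow> real"
  assumes x: "\<And>i. i \<in> I \<Longrightarrow> x i \<in> measure_support \<rho>"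
  shows "0 \<le> (\<Sum>i\<in>I. \<Sum>j\<in>I. a i * a j * L_fun \<tau> (x i) (x j))"
proof (rule field_le_epsilon)
  fix e :: real assume e: "0 < e"
  define A where "A = (\<Sum>i\<in>I. \<Sum>j\<in>I. \<bar>a i * a j\<bar>)"
  have A: "0 \<le> A" unfolding A_def by (intro sum_nonneg) auto
  \<comment> \<open>Makes the total error 2 * L_bound \<tau> * r * A at most e; the 1 keeps the
    denominator positive.\<close>
  define r where "r = e / (2 * L_bound \<tau> * A + 1)"
  have r: "0 < r" using e A by (simp add: r_def add_nonneg_pos)
  have re: "2 * L_bound \<tau> * r * A \<le> e"
  proof -
    have "2 * L_bound \<tau> * r * A = e * ((2 * L_bound \<tau> * A) / (2 * L_bound \<tau> * A + 1))"
      by (simp add: r_def)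
    also have "\<dots> \<le> e * 1"
      using e A by (intro mult_left_mono) (auto simp: divide_le_eq_1 add_nonneg_pos)
    finally show ?thesis by simp
  qed
  define U where "U i = S1 \<inter> ball (x i) r" for i
  have opU: "openin (top_of_set S1) (U i)" for i by (simp add: U_def openin_open_Int)
  have xS: "x i \<in> S1" if "i \<in> I" for i using x[OF that] support_subset by auto
  have p: "0 < prob (U i)" if "i \<in> I" for i
    using openin_support_pos[OF x[OF that] opU] xS[OF that] r by (simp add: U_def)
  define \<psi> where "\<psi> i y = a i / prob (U i) * indicator (U i) y" for i y
  have b: "bdd_meas (\<psi> i)" for i
    unfolding \<psi>_def by (intro bdd_meas_mult bdd_meas_const bdd_meas_indicator openin_sets opU)
  let ?f = "\<lambda>y. \<Sum>i\<in>I. \<psi> i y"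
  have bf: "bdd_meas ?f" by (intro bdd_meas_sum b)
  have "form \<tau> ?f ?f = (\<Sum>i\<in>I. form \<tau> (\<psi> i) ?f)" by (intro form_sum_left b bf)
  also have "\<dots> = (\<Sum>i\<in>I. \<Sum>j\<in>I. form \<tau> (\<psi> j) (\<psi> i))"
    by (simp add: form_commute[OF b bf] form_sum_left[OF b b])
  also have "\<dots> \<le> (\<Sum>i\<in>I. \<Sum>j\<in>I. a i * a j * L_fun \<tau> (x i) (x j) + \<bar>a i * a j\<bar> * (2 * L_bound \<tau> * r))"
  proof (intro sum_mono)
    fix i j assume ij: "i \<in> I" "j \<in> I"
    define l where "l = L_fun \<tau> (x j) (x i)"
    define F where "F = form \<tau> (indicator (U j)) (indicator (U i))"
    have "\<bar>F - prob (U j) * prob (U i) * l\<bar> \<le> prob (U j) * prob (U i) * (2 * L_bound \<tau> * r)"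
      unfolding F_def
    proof (rule form_bounds[OF openin_sets[OF opU] openin_sets[OF opU]])
      fix y z assume yz: "y \<in> U j" "z \<in> U i"
      have "\<bar>L_fun \<tau> y z - l\<bar> \<le> L_bound \<tau> * (norm (y - x j) + norm (z - x i))"
        unfolding l_def using yz xS ij by (intro L_fun_lipschitz2) (auto simp: U_def)
      also have "\<dots> \<le> L_bound \<tau> * (r + r)"
        using yz by (intro mult_left_mono add_mono) (auto simp: U_def dist_norm norm_minus_commute)
      finally show "\<bar>L_fun \<tau> y z - l\<bar> \<le> 2 * L_bound \<tau> * r" by simp
    qed
    then have "\<bar>F / (prob (U j) * prob (U i)) - l\<bar> \<le> 2 * L_bound \<tau> * r"
      using p[OF ij(1)] p[OF ij(2)] by (simp add: abs_le_iff field_simps)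
    then have "\<bar>a i * a j\<bar> * \<bar>F / (prob (U j) * prob (U i)) - l\<bar> \<le> \<bar>a i * a j\<bar> * (2 * L_bound \<tau> * r)"
      by (rule mult_left_mono) simp
    then have "a i * a j * (F / (prob (U j) * prob (U i)) - l) \<le> \<bar>a i * a j\<bar> * (2 * L_bound \<tau> * r)"
      unfolding abs_mult[symmetric] by linarith
    moreover have "form \<tau> (\<psi> j) (\<psi> i) = a i * a j * (F / (prob (U j) * prob (U i)))"
    proof -
      have "form \<tau> (\<psi> j) (\<psi> i) = a j / prob (U j) * form \<tau> (indicator (U j)) (\<psi> i)"
        unfolding \<psi>_def[of j] by (rule form_scale_left)
      also have "form \<tau> (indicator (U j)) (\<psi> i) = form \<tau> (\<psi> i) (indicator (U j))"
        by (intro form_commute b bdd_meas_indicator openin_sets opU)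
      also have "\<dots> = a i / prob (U i) * form \<tau> (indicator (U i)) (indicator (U j))"
        unfolding \<psi>_def[of i] by (rule form_scale_left)
      also have "form \<tau> (indicator (U i)) (indicator (U j)) = F"
        unfolding F_def by (intro form_commute bdd_meas_indicator openin_sets opU)
      finally show ?thesis by simp
    qed
    ultimately show "form \<tau> (\<psi> j) (\<psi> i) \<le> a i * a j * L_fun \<tau> (x i) (x j) + \<bar>a i * a j\<bar> * (2 * L_bound \<tau> * r)"
      by (simp add: l_def L_fun_commute[of \<tau> "x j"] algebra_simps)
  qed
  also have "\<dots> = (\<Sum>i\<in>I. \<Sum>j\<in>I. a i * a j * L_fun \<tau> (x i) (x j)) + 2 * L_bound \<tau> * r * A"
    by (simp add: sum.distrib A_def sum_distrib_left sum_distrib_right mult_ac)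
  finally show "0 \<le> (\<Sum>i\<in>I. \<Sum>j\<in>I. a i * a j * L_fun \<tau> (x i) (x j)) + e"
    using form_nonneg[OF bf] re by linarith
qed

end

section \<open>Geometry of the support\<close>

lemma circ_periodic_int [simp]: "circ (s + 2 * pi * of_int k) = circ s"
proof -
  have "cos (2 * pi * real_of_int k) = 1" using cos_int_2pin[of k] by (simp add: mult_ac)
  then show ?thesis by (simp add: circ_eq_iff)
qed

lemma angle_reduce:
  obtains k :: int where "\<bar>u - 2 * pi * of_int k\<bar> \<le> pi"
proof -
  define k where "k = round (u / (2 * pi))"
  have "\<bar>u / (2 * pi) - of_int k\<bar> \<le> 1/2"
    using of_int_round_abs_le[of "u / (2 * pi)"] by (simp add: k_def abs_minus_commute)
  then have "\<bar>(2 * pi) * (u / (2 * pi) - of_int k)\<bar> \<le> (2 * pi) * (1/2)"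
    unfolding abs_mult by (intro mult_mono) auto
  then show ?thesis by (intro that[of k]) (simp add: algebra_simps)
qed

lemma cos_reduce: "cos (u - 2 * pi * of_int k) = cos u"
  using circ_periodic_int[of "u - 2 * pi * of_int k" k] circ_nth(1) by (metis diff_add_cancel)

lemma shift_into_period:
  obtains k :: int where "a \<le> u + 2 * pi * of_int k" "u + 2 * pi * of_int k < a + 2 * pi"
proof -
  define k where "k = \<lfloor>(u - a) / (2 * pi)\<rfloor>"
  have "of_int k \<le> (u - a) / (2 * pi)" "(u - a) / (2 * pi) < of_int k + 1"
    by (auto simp: k_def)
  then have "2 * pi * of_int k \<le> u - a" "u - a < 2 * pi * (of_int k + 1)"
    by (auto simp: field_simps)
  then show ?thesis by (intro that[of "- k"]) (auto simp: algebra_simps)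
qed

lemma circ_inj_period:
  assumes "circ r = circ s" "\<bar>r - s\<bar> < 2 * pi" shows "r = s"
proof -
  have "cos (r - s) = 1" using assms(1) by (simp add: circ_eq_iff)
  then obtain k :: int where k: "r - s = of_int k * 2 * pi"
    using cos_one_2pi_int by blast
  have "\<bar>real_of_int k\<bar> * (2 * pi) < 1 * (2 * pi)" using assms(2) by (simp add: k abs_mult)
  then have "\<bar>real_of_int k\<bar> < 1" by (rule mult_right_less_imp_less) simp
  then have "k = 0" by linarith
  then show ?thesis using k by simp
qed

definition rot :: "real \<Rightarrow> real ^ 2 ^ 2" where
  "rot h = vector [vector [cos h, - sin h], vector [sin h, cos h]]"

lemma rot_circ: "rot h *v circ s = circ (s + h)"
  by (simp add: vec_eq_iff forall_2 matrix_vector_mult_def sum_2 rot_def cos_add sin_add algebra_simps)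

lemma rotation_matrix_rot: "rotation_matrix (rot h)"
proof -
  have "orthogonal_matrix (rot h)"
    unfolding orthogonal_matrix
    by (simp add: vec_eq_iff forall_2 matrix_matrix_mult_def sum_2 rot_def transpose_def mat_def
        power2_eq_square[symmetric])
  moreover have "det (rot h) = 1"
    by (simp add: det_2 rot_def power2_eq_square[symmetric])
  ultimately show ?thesis by (simp add: rotation_matrix_def)
qed

lemma rot_in_S1: "x \<in> S1 \<Longrightarrow> rot h *v x \<in> S1"
  by (elim circ_surj) (simp add: rot_circ)

lemma L_fun_rot: "x \<in> S1 \<Longrightarrow> y \<in> S1 \<Longrightarrow> L_fun \<tau> (rot h *v x) (rot h *v y) = L_fun \<tau> x y"
  by (elim circ_surj) (simp add: rot_circ L_fun_circ)

lemma measurable_rot [measurable]: "(\<lambda>x. rot h *v x) \<in> borel_measurable borel"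
  by (intro borel_measurable_continuous_onI linear_continuous_on)
     (simp add: linear_conv_bounded_linear[symmetric])

section \<open>Measures with finite support\<close>

context circle_measure
begin

lemma singleton_sets: "x \<in> S1 \<Longrightarrow> {x} \<in> sets \<rho>"
  by (simp add: in_sets)

lemma integral_finite_support:
  fixes f :: "plane \<Rightarrow> real"
  assumes fin: "finite (measure_support \<rho>)" and f: "f \<in> borel_measurable \<rho>"
  shows "(\<integral>x. f x \<partial>\<rho>) = (\<Sum>y\<in>measure_support \<rho>. prob {y} * f y)"
proof -
  let ?P = "measure_support \<rho>"
  have PS: "y \<in> S1" if "y \<in> ?P" for y using that support_subset by (rule rev_subsetD)
  have [measurable]: "{y} \<in> sets \<rho>" if "y \<in> ?P" for y by (intro singleton_sets PS that)
  have "(\<integral>x. f x \<partial>\<rho>) = (\<integral>x. (\<Sum>y\<in>?P. f y * indicator {y} x) \<partial>\<rho>)"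
  proof (rule integral_cong_AE)
    show "AE x in \<rho>. f x = (\<Sum>y\<in>?P. f y * indicator {y} x)"
      using AE_support
    proof eventually_elim
      case (elim x)
      then show ?case using fin by (simp add: indicator_def sum.delta')
    qed
  qed (use f in measurable)
  also have "\<dots> = (\<Sum>y\<in>?P. \<integral>x. f y * indicator {y} x \<partial>\<rho>)"
    by (rule Bochner_Integration.integral_sum)
       (intro bdd_meas_integrable bdd_meas_mult bdd_meas_const bdd_meas_indicator singleton_sets PS)
  also have "\<dots> = (\<Sum>y\<in>?P. prob {y} * f y)"
    by (intro sum.cong refl) (use PS in \<open>simp add: Int_absorb2\<close>)
  finally show ?thesis .
qed

text \<open>Without the other support points the circle is still an open neighbourhood of y; its
  mass is positive and sits entirely at y.\<close>

lemma prob_singleton_pos: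
  assumes fin: "finite (measure_support \<rho>)" and y: "y \<in> measure_support \<rho>"
  shows "0 < prob {y}"
proof -
  let ?P = "measure_support \<rho>"
  let ?U = "S1 - (?P - {y})"
  have yS: "y \<in> S1" using y support_subset by (rule rev_subsetD)
  have "openin (top_of_set S1) ?U"
    using fin by (intro openin_diff) (auto intro!: closed_subset finite_imp_closed
        dest: subsetD[OF support_subset])
  then have "0 < prob ?U" "?U \<in> sets \<rho>" using openin_support_pos[OF y] yS openin_sets by auto
  moreover have "prob ?U = (\<integral>x. indicator ?U x \<partial>\<rho>)" using \<open>?U \<in> sets \<rho>\<close> by (simp add: Int_absorb2)
  moreover have "(\<integral>x. indicator ?U x \<partial>\<rho>) = (\<Sum>z\<in>?P. prob {z} * indicator ?U z)"
    by (rule integral_finite_support[OF fin bdd_meas_measurable[OF bdd_meas_indicator[OF \<open>?U \<in> sets \<rho>\<close>]]])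
  moreover have "(\<Sum>z\<in>?P. prob {z} * indicator ?U z) = (\<Sum>z\<in>?P. if z = y then prob {z} else 0)"
    by (intro sum.cong refl) (use yS in \<open>auto simp: indicator_def\<close>)
  ultimately show ?thesis using fin y by simp
qed

lemma potential_finite:
  assumes "finite (measure_support \<rho>)"
  shows "potential \<tau> x = (\<Sum>y\<in>measure_support \<rho>. prob {y} * L_fun \<tau> x y)"
  unfolding potential_def by (rule integral_finite_support[OF assms]) measurable

end

context large_tau
begin

lemma cos_less_theta_reduce:
  assumes "cos \<theta> < cos u" obtains k :: int where "\<bar>u - 2 * pi * of_int k\<bar> < \<theta>"
proof -
  obtain k :: int where k: "\<bar>u - 2 * pi * of_int k\<bar> \<le> pi" by (rule angle_reduce)
  have "cos \<theta> < cos \<bar>u - 2 * pi * of_int k\<bar>" using assms by (simp add: cos_reduce)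
  then have "\<bar>u - 2 * pi * of_int k\<bar> < \<theta>"
    using k theta_bounds by (subst (asm) cos_mono_less_eq) auto
  then show ?thesis by (rule that)
qed

lemma cos_eq_theta_reduce:
  assumes "cos u = cos \<theta>" obtains k :: int where "\<bar>u - 2 * pi * of_int k\<bar> = \<theta>"
proof -
  obtain k :: int where k: "\<bar>u - 2 * pi * of_int k\<bar> \<le> pi" by (rule angle_reduce)
  have "cos \<theta> = cos \<bar>u - 2 * pi * of_int k\<bar>" using assms by (simp add: cos_reduce)
  then have "\<bar>u - 2 * pi * of_int k\<bar> = \<theta>"
    using k theta_bounds cos_inj_pi[of "\<bar>u - 2 * pi * of_int k\<bar>" \<theta>] by simp
  then show ?thesis by (rule that)
qed

end

section \<open>The support lifted to the real line: partners, gaps and finiteness\<close>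

locale large_minimizer = circle_minimizer \<rho> \<tau> + large_tau \<tau> for \<rho> \<tau>
begin

text \<open>The lift to the universal cover, a closed 2 pi-periodic set. On the line, unlike on the
  circle, neighbours and gaps are given by the order.\<close>

definition \<Theta> :: "real set" where "\<Theta> = {s. circ s \<in> measure_support \<rho>}"

lemma Theta_shift: "s \<in> \<Theta> \<Longrightarrow> s + 2 * pi * of_int k \<in> \<Theta>"
  by (simp add: \<Theta>_def)

lemma Theta_shift_iff [simp]: "s + 2 * pi \<in> \<Theta> \<longleftrightarrow> s \<in> \<Theta>" "s - 2 * pi \<in> \<Theta> \<longleftrightarrow> s \<in> \<Theta>"
  by (simp_all add: \<Theta>_def)

lemma closed_Theta: "closed \<Theta>"
proof -
  have "continuous_on UNIV circ" by (intro continuous_intros)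
  then have "closed (circ -` measure_support \<rho>)"
    using closed_support by (intro closed_vimage) auto
  then show ?thesis by (simp add: \<Theta>_def vimage_def)
qed

lemma support_Theta: assumes "x \<in> measure_support \<rho>" obtains s where "x = circ s" "s \<in> \<Theta>"
proof -
  have "x \<in> S1" using assms support_subset by (rule rev_subsetD)
  then obtain s where "x = circ s" by (rule circ_surj)
  then show ?thesis using assms by (intro that[of s]) (simp_all add: \<Theta>_def)
qed

text \<open>Without mass at distance \<open>\<theta>\<close> from \<open>circ s\<close>, only the strictly concave part of the kernel
  would be seen near \<open>circ s\<close>, so that the potential could not have a minimum there.\<close>

lemma Theta_neighbour:
  assumes s: "s \<in> \<Theta>" shows "s + \<theta> \<in> \<Theta> \<or> s - \<theta> \<in> \<Theta>"
proof (rule ccontr)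
  assume no: "\<not> (s + \<theta> \<in> \<Theta> \<or> s - \<theta> \<in> \<Theta>)"
  let ?P = "measure_support \<rho>"
  have xP: "circ s \<in> ?P" using s by (simp add: \<Theta>_def)
  have ne: "circ s \<bullet> y \<noteq> cos \<theta>" if y: "y \<in> ?P" for y
  proof
    assume eq: "circ s \<bullet> y = cos \<theta>"
    obtain r where r: "y = circ r" "r \<in> \<Theta>" using y by (rule support_Theta)
    obtain k :: int where "\<bar>s - r - 2 * pi * of_int k\<bar> = \<theta>"
      using eq r by (auto simp: circ_inner elim: cos_eq_theta_reduce)
    then have "r + 2 * pi * of_int k = s + \<theta> \<or> r + 2 * pi * of_int k = s - \<theta>" by linarith
    then show False using Theta_shift[OF r(2), of k] no by auto
  qed
  have "compact ?P"
    using compact_Int_closed[OF compact_sphere closed_support] support_subset by (metis inf.absorb2)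
  moreover have "continuous_on ?P (\<lambda>y. \<bar>circ s \<bullet> y - cos \<theta>\<bar>)" by (intro continuous_intros)
  ultimately obtain y0 where y0: "y0 \<in> ?P" "\<And>y. y \<in> ?P \<Longrightarrow> \<bar>circ s \<bullet> y0 - cos \<theta>\<bar> \<le> \<bar>circ s \<bullet> y - cos \<theta>\<bar>"
    using continuous_attains_inf[of ?P "\<lambda>y. \<bar>circ s \<bullet> y - cos \<theta>\<bar>"] support_nonempty by blast
  \<comment> \<open>The support is not yet known to be finite, so compactness provides the positive
    distance from the kink that makes one h work for all y. The cap 1 is demanded by
    \<open>K_second_difference\<close>.\<close>
  define h where "h = min 1 \<bar>circ s \<bullet> y0 - cos \<theta>\<bar>"
  have h: "0 < h" "h \<le> 1" using ne[OF y0(1)] by (auto simp: h_def)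
  have hy: "h \<le> \<bar>circ s \<bullet> y - cos \<theta>\<bar>" if "y \<in> ?P" for y using y0(2)[OF that] by (simp add: h_def)
  \<comment> \<open>Minus the second difference of the kernel in s. Its integral is minus that of
    the potential, hence at most 0, because the potential is minimal at
    \<open>circ s\<close>.\<close>
  define g where "g y = 2 * L_fun \<tau> (circ s) y - L_fun \<tau> (circ (s + h)) y - L_fun \<tau> (circ (s - h)) y" for y
  have g_nonneg: "0 \<le> g y" and g_pos: "cos \<theta> < circ s \<bullet> y \<Longrightarrow> 0 < g y" if y: "y \<in> ?P" for y
  proof -
    obtain r where r: "y = circ r" "r \<in> \<Theta>" using y by (rule support_Theta)
    have "g y = 2 * K (s - r) - (K (s - r + h) + K (s - r - h))"
      by (simp add: g_def r L_fun_circ algebra_simps)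
    moreover have "h \<le> \<bar>cos (s - r) - cos \<theta>\<bar>" using hy[OF y] by (simp add: r circ_inner)
    ultimately show "0 \<le> g y" "cos \<theta> < circ s \<bullet> y \<Longrightarrow> 0 < g y"
      using K_second_difference[OF h, of "s - r"] by (auto simp: r circ_inner)
  qed
  have int: "integrable \<rho> (L_fun \<tau> (circ u))" for u using integrable_L[of "circ u"] by simp
  have "(\<integral>y. g y \<partial>\<rho>) = 2 * \<phi> (circ s) - \<phi> (circ (s + h)) - \<phi> (circ (s - h))"
    unfolding g_def potential_def using int by simp
  also have "\<dots> \<le> 0"
    using potential_eq[OF xP] potential_ge[of "circ (s + h)"] potential_ge[of "circ (s - h)"] by simp
  finally have le: "(\<integral>y. g y \<partial>\<rho>) \<le> 0" .
  have g0: "AE y in \<rho>. 0 \<le> g y" using AE_support by eventually_elim (rule g_nonneg)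
  have ig: "integrable \<rho> g" unfolding g_def using int by simp
  have "(\<integral>y. g y \<partial>\<rho>) = 0" using le integral_nonneg_AE[OF g0] by simp
  then have "AE y in \<rho>. g y = 0" using integral_nonneg_eq_0_iff_AE[OF ig g0] by simp
  then have AEV: "AE y in \<rho>. \<not> cos \<theta> < circ s \<bullet> y"
    using AE_support
  proof eventually_elim
    case (elim y)
    then show ?case using g_pos[of y] by force
  qed
  \<comment> \<open>\<open>?V\<close> has been found to carry no mass, but it is a neighbourhood of
    the support point \<open>circ s\<close>.\<close>
  let ?V = "S1 \<inter> {y. cos \<theta> < circ s \<bullet> y}"
  have op: "openin (top_of_set S1) ?V"
    by (intro openin_open_Int open_Collect_less continuous_intros)
  have "AE y in \<rho>. y \<notin> ?V" using AEV by eventually_elim simp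
  then have "emeasure \<rho> ?V = 0" using AE_iff_null_sets[OF openin_sets[OF op]] by auto
  then have "prob ?V = 0" by (simp add: measure_def)
  have "circ s \<in> ?V" using cos_theta_bounds by (simp add: circ_inner)
  then have "0 < prob ?V" by (rule openin_support_pos[OF xP op])
  with \<open>prob ?V = 0\<close> show False by linarith
qed

text \<open>The Gram matrix of the kernel at \<open>circ s\<close>, \<open>circ (s + \<theta>)\<close> and an intermediate point would have
  a negative determinant.\<close>

lemma Theta_gap:
  assumes s: "s \<in> \<Theta>" "s + \<theta> \<in> \<Theta>" and r: "s < r" "r < s + \<theta>"
  shows "r \<notin> \<Theta>"
proof
  assume rT: "r \<in> \<Theta>"
  define a b where "a = K (r - s)" and "b = K (s + \<theta> - r)"
  define x where "x i = (if i = 0 then circ s else if i = 1 then circ (s + \<theta>) else circ r)" for i :: nat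
  \<comment> \<open>Up to the factor K 0, the third column of the adjugate of the Gram matrix. In
    this direction the quadratic form equals the determinant.\<close>
  define c where "c i = (if i = 0 then - a else if i = 1 then - b else K 0)" for i :: nat
  have x: "x 0 = circ s" "x 1 = circ (s + \<theta>)" "x 2 = circ r" by (simp_all add: x_def)
  have c: "c 0 = - a" "c 1 = - b" "c 2 = K 0" by (simp_all add: c_def)
  have L: "L_fun \<tau> (circ u) (circ u) = K 0" for u by (simp add: L_fun_circ)
  have L01: "L_fun \<tau> (circ s) (circ (s + \<theta>)) = 0" by (simp add: L_fun_circ)
  have L02: "L_fun \<tau> (circ s) (circ r) = a" unfolding a_def L_fun_circ by (rule L_angle_commute)
  have L12: "L_fun \<tau> (circ (s + \<theta>)) (circ r) = b" by (simp add: b_def L_fun_circ)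
  have L': "L_fun \<tau> (circ (s + \<theta>)) (circ s) = 0" "L_fun \<tau> (circ r) (circ s) = a"
    "L_fun \<tau> (circ r) (circ (s + \<theta>)) = b"
    using L01 L02 L12 by (simp_all add: L_fun_commute)
  have "x i \<in> measure_support \<rho>" for i using s rT by (auto simp: x_def \<Theta>_def)
  then have "0 \<le> (\<Sum>i\<in>{0,1,2}. \<Sum>j\<in>{0,1,2}. c i * c j * L_fun \<tau> (x i) (x j))"
    by (intro support_gram_nonneg)
  also have "\<dots> = c 0 * c 0 * L_fun \<tau> (x 0) (x 0) + c 0 * c 1 * L_fun \<tau> (x 0) (x 1) + c 0 * c 2 * L_fun \<tau> (x 0) (x 2)
      + (c 1 * c 0 * L_fun \<tau> (x 1) (x 0) + c 1 * c 1 * L_fun \<tau> (x 1) (x 1) + c 1 * c 2 * L_fun \<tau> (x 1) (x 2))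
      + (c 2 * c 0 * L_fun \<tau> (x 2) (x 0) + c 2 * c 1 * L_fun \<tau> (x 2) (x 1) + c 2 * c 2 * L_fun \<tau> (x 2) (x 2))"
    by simp
  also have "\<dots> = K 0 * ((K 0)\<^sup>2 - a\<^sup>2 - b\<^sup>2)"
    unfolding x c L L01 L02 L12 L' by (simp add: power2_eq_square algebra_simps)
  finally have "0 \<le> (K 0)\<^sup>2 - a\<^sup>2 - b\<^sup>2" using K_0_pos by (simp add: zero_le_mult_iff)
  moreover have "b = K (\<theta> - (r - s))" by (simp add: b_def algebra_simps)
  ultimately show False using key_inequality[of "r - s"] r by (simp add: a_def)
qed

text \<open>The partner of q is q + \<theta> or q - \<theta>. Were r - p < \<theta>, then r or p
  would lie strictly between q and that partner, which \<open>Theta_gap\<close> forbids.\<close>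

lemma Theta_three:
  assumes "p \<in> \<Theta>" "q \<in> \<Theta>" "r \<in> \<Theta>" "p < q" "q < r" shows "\<theta> \<le> r - p"
proof (rule ccontr)
  assume lt: "\<not> \<theta> \<le> r - p"
  from Theta_neighbour[OF assms(2)] show False
  proof
    assume "q + \<theta> \<in> \<Theta>"
    moreover have "r < q + \<theta>" using lt assms(4) by linarith
    ultimately show False using Theta_gap[OF assms(2) _ assms(5)] assms(3) by blast
  next
    assume q: "q - \<theta> \<in> \<Theta>"
    have "q - \<theta> + \<theta> \<in> \<Theta>" using assms(2) by simp
    moreover have "q - \<theta> < p" "p < q - \<theta> + \<theta>" using lt assms(4,5) by linarith+
    ultimately show False using Theta_gap[OF q] assms(1) by blast
  qed
qed

text \<open>The half-open window matters: any three of its points span less than \<theta>, against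
  \<open>Theta_three\<close>.\<close>

lemma finite_Theta_window: "finite (\<Theta> \<inter> {a..<a + \<theta>})"
proof (rule ccontr)
  assume "infinite (\<Theta> \<inter> {a..<a + \<theta>})"
  then obtain F where F: "F \<subseteq> \<Theta> \<inter> {a..<a + \<theta>}" "finite F" "card F = 3"
    using infinite_arbitrarily_large by blast
  then have ne: "F \<noteq> {}" by auto
  have "\<not> F \<subseteq> {Min F, Max F}"
  proof
    assume "F \<subseteq> {Min F, Max F}"
    then have "card F \<le> card {Min F, Max F}" by (rule card_mono[rotated]) simp
    also have "\<dots> \<le> 2" by (simp add: card_insert_if)
    finally show False using F(3) by simp
  qed
  then obtain q where q: "q \<in> F" "q \<noteq> Min F" "q \<noteq> Max F" by blast
  have mem: "u \<in> \<Theta>" "a \<le> u" "u < a + \<theta>" if "u \<in> F" for u using F(1) that by auto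
  have "Min F < q" "q < Max F"
    using q Min_le[OF F(2) q(1)] Max_ge[OF F(2) q(1)] by (auto simp: order_less_le)
  with Theta_three[OF mem(1)[OF Min_in[OF F(2) ne]] mem(1)[OF q(1)] mem(1)[OF Max_in[OF F(2) ne]]]
  have "\<theta> \<le> Max F - Min F" by blast
  then show False using mem(2)[OF Min_in[OF F(2) ne]] mem(3)[OF Max_in[OF F(2) ne]] by linarith
qed

lemma finite_support: "finite (measure_support \<rho>)"
proof -
  obtain N :: nat where N: "2 * pi < real N * \<theta>"
    using reals_Archimedean3[OF theta_bounds(1)] by blast
  have "measure_support \<rho> \<subseteq> (\<Union>i<N. circ ` (\<Theta> \<inter> {real i * \<theta>..<real i * \<theta> + \<theta>}))"
  proof
    fix x assume "x \<in> measure_support \<rho>"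
    then obtain s where s: "x = circ s" "s \<in> \<Theta>" by (rule support_Theta)
    obtain k :: int where k: "0 \<le> s + 2 * pi * of_int k" "s + 2 * pi * of_int k < 0 + 2 * pi"
      by (rule shift_into_period)
    define r where "r = s + 2 * pi * of_int k"
    have r: "0 \<le> r" "r < 2 * pi" "r \<in> \<Theta>" "x = circ r"
      using k s Theta_shift[OF s(2), of k] by (auto simp: r_def)
    define i where "i = nat \<lfloor>r / \<theta>\<rfloor>"
    have "real i = of_int \<lfloor>r / \<theta>\<rfloor>" using r(1) theta_bounds by (simp add: i_def)
    then have "real i \<le> r / \<theta>" "r / \<theta> < real i + 1" by linarith+
    then have i: "real i * \<theta> \<le> r" "r < real i * \<theta> + \<theta>"
      using theta_bounds by (auto simp: field_simps)
    then have "real i * \<theta> < real N * \<theta>" using r(2) N by linarith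
    then have "i < N" using theta_bounds by simp
    then show "x \<in> (\<Union>i<N. circ ` (\<Theta> \<inter> {real i * \<theta>..<real i * \<theta> + \<theta>}))"
      using r(3,4) i by force
  qed
  then show ?thesis by (rule finite_subset) (auto simp: finite_Theta_window)
qed

text \<open>Otherwise let q be the end of the gap. The point s + \<theta> lies inside the gap and
  can interact with q only, so its potential is the mass of q times a value below K 0. But the mass
  of q times K 0 is already at most \<phi>(q) = S.\<close>

lemma Theta_nonempty_after:
  assumes s: "s \<in> \<Theta>" shows "\<Theta> \<inter> {s<..s + \<theta>} \<noteq> {}"
proof
  assume empty: "\<Theta> \<inter> {s<..s + \<theta>} = {}"
  define q where "q = Inf (\<Theta> \<inter> {s + \<theta>..})"
  have ne: "s + 2 * pi \<in> \<Theta> \<inter> {s + \<theta>..}" using s theta_bounds pi_gt_zero by simp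
  have bdd: "bdd_below (\<Theta> \<inter> {s + \<theta>..})" by (rule bdd_belowI[of _ "s + \<theta>"]) auto
  have qin: "q \<in> \<Theta> \<inter> {s + \<theta>..}"
    unfolding q_def by (rule closed_contains_Inf[OF _ bdd closed_Int[OF closed_Theta closed_atLeast]]) (use ne in blast)
  then have q: "q \<in> \<Theta>" "s + \<theta> < q"
    using empty theta_bounds by (auto simp: order_less_le)
  have least: "q \<le> r" if "r \<in> \<Theta>" "s < r" for r
  proof (cases "r \<le> s + \<theta>")
    case True
    then show ?thesis using empty that by auto
  next
    case False
    then show ?thesis unfolding q_def using that bdd by (intro cInf_lower) auto
  qed
  \<comment> \<open>q - \<theta> falls into the gap, so the partner of q is q + \<theta>, and
    \<open>Theta_gap\<close> clears the interval up to it.\<close>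
  have "q - \<theta> \<notin> \<Theta>" using least[of "q - \<theta>"] q theta_bounds by auto
  then have qn: "q + \<theta> \<in> \<Theta>" using Theta_neighbour[OF q(1)] by simp
  let ?z = "circ (s + \<theta>)"
  have only: "y = circ q" if y: "y \<in> measure_support \<rho>" and pos: "L_fun \<tau> ?z y \<noteq> 0" for y
  proof -
    obtain r where r: "y = circ r" "r \<in> \<Theta>" using y by (rule support_Theta)
    have "0 < K (s + \<theta> - r)" using pos L_fun_nonneg[of \<tau> ?z y] by (simp add: r L_fun_circ order_less_le)
    then obtain k :: int where k: "\<bar>s + \<theta> - r - 2 * pi * of_int k\<bar> < \<theta>"
      by (auto simp: K_pos_iff elim: cos_less_theta_reduce)
    define r' where "r' = r + 2 * pi * of_int k"
    have r': "r' \<in> \<Theta>" "circ r' = y" using r Theta_shift[OF r(2), of k] by (auto simp: r'_def)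
    have "s < r'" "r' < s + \<theta> + \<theta>" using k by (auto simp: r'_def)
    then have "q \<le> r'" "r' < q + \<theta>" using least r'(1) q by auto
    then have "r' = q" using Theta_gap[OF q(1) qn, of r'] r'(1) by force
    then show ?thesis using r'(2) by simp
  qed
  have qP: "circ q \<in> measure_support \<rho>" using q by (simp add: \<Theta>_def)
  have "\<phi> ?z = (\<Sum>y\<in>measure_support \<rho>. if y = circ q then prob {y} * L_fun \<tau> ?z y else 0)"
    unfolding potential_finite[OF finite_support] using only by (intro sum.cong refl) auto
  also have "\<dots> = prob {circ q} * K (s + \<theta> - q)"
    using qP finite_support by (simp add: L_fun_circ)
  finally have z: "\<phi> ?z = prob {circ q} * K (s + \<theta> - q)" .
  have "prob {circ q} * L_fun \<tau> (circ q) (circ q) \<le> \<phi> (circ q)"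
    unfolding potential_finite[OF finite_support]
    using qP by (rule member_le_sum) (auto simp: finite_support)
  then have "prob {circ q} * K 0 \<le> \<phi> (circ q)" by (simp add: L_fun_circ)
  also have "\<dots> = S" by (rule potential_eq[OF qP])
  also have "\<dots> \<le> prob {circ q} * K (s + \<theta> - q)" unfolding z[symmetric] by (rule potential_ge) simp
  finally have le: "K 0 \<le> K (s + \<theta> - q)" using prob_singleton_pos[OF finite_support qP] by simp
  have "s + \<theta> \<notin> \<Theta>" using empty theta_bounds by auto
  then have "circ (s + \<theta>) \<noteq> circ q" using qP by (auto simp: \<Theta>_def)
  then have "cos (s + \<theta> - q) < 1" using cos_le_one[of "s + \<theta> - q"] by (simp add: circ_eq_iff order_less_le)
  then show False using K_less le by force
qed

lemma Theta_next:
  assumes s: "s \<in> \<Theta>"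
  obtains r where "r \<in> \<Theta>" "s < r" "r \<le> s + \<theta>" "\<And>q. s < q \<Longrightarrow> q < r \<Longrightarrow> q \<notin> \<Theta>"
proof -
  let ?T = "\<Theta> \<inter> {s<..s + \<theta>}"
  have "?T \<subseteq> (\<Theta> \<inter> {s..<s + \<theta>}) \<union> {s + \<theta>}" by auto
  then have fin: "finite ?T" by (rule finite_subset) (simp add: finite_Theta_window)
  have "Min ?T \<in> ?T" using fin Theta_nonempty_after[OF s] by (rule Min_in)
  moreover have "q \<notin> \<Theta>" if "s < q" "q < Min ?T" for q
  proof
    assume "q \<in> \<Theta>"
    then have "q \<in> ?T" using that \<open>Min ?T \<in> ?T\<close> by auto
    from Min_le[OF fin this] that(2) show False by linarith
  qed
  ultimately show ?thesis using that[of "Min ?T"] by auto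
qed

end

lemma finite_pos_lower_bound:
  fixes d :: "'a \<Rightarrow> real"
  assumes "finite A" "\<And>p. p \<in> A \<Longrightarrow> 0 < d p"
  obtains h where "0 < h" "h \<le> 1" "\<And>p. p \<in> A \<Longrightarrow> h \<le> d p"
proof -
  define h where "h = Min (insert 1 (d ` A))"
  have fin: "finite (insert 1 (d ` A))" using assms(1) by simp
  have "0 < h" unfolding h_def using assms(2) fin by (subst Min_gr_iff) auto
  moreover have "h \<le> 1" unfolding h_def by (rule Min_le[OF fin]) simp
  moreover have "h \<le> d p" if "p \<in> A" for p unfolding h_def by (rule Min_le[OF fin]) (simp add: that)
  ultimately show ?thesis by (rule that)
qed

section \<open>Moving an arc of the support and the resulting chain\<close>

context circle_measure
begin

definition shift_on :: "plane set \<Rightarrow> real \<Rightarrow> plane \<Rightarrow> plane" where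
  "shift_on A h x = (if x \<in> A then rot h *v x else x)"

text \<open>The competitor behind \<open>no_two_short_gaps\<close>: the masses are kept and only the
  kernel values of the pairs change.\<close>

lemma action_shift_on:
  assumes fin: "finite (measure_support \<rho>)" and A: "A \<subseteq> measure_support \<rho>"
  shows "min_action \<tau> \<le> (\<Sum>p\<in>measure_support \<rho>. \<Sum>q\<in>measure_support \<rho>.
    prob {p} * prob {q} * L_fun \<tau> (shift_on A h p) (shift_on A h q))"
proof -
  let ?P = "measure_support \<rho>" and ?T = "shift_on A h"
  have "A \<in> sets \<rho>"
    using finite_subset[OF A fin] A support_subset by (auto simp: in_sets intro!: borel_closed finite_imp_closed)
  then have Tm [measurable]: "?T \<in> borel_measurable \<rho>"
    unfolding shift_on_def by (intro measurable_If_set measurable_compose[OF measurable_ident_rho measurable_rot]) auto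
  have TS: "x \<in> space \<rho> \<Longrightarrow> ?T x \<in> S1" for x
    unfolding shift_on_def using rot_in_S1[of x h] by simp
  have "min_action \<tau> \<le> action \<tau> (distr \<rho> (restrict_space borel S1) ?T)"
    by (rule min_action_le[OF circle_measure_distr(1)[OF prob_space_axioms Tm TS]])
  also have "\<dots> = (\<integral>x. \<integral>y. L_fun \<tau> (?T x) (?T y) \<partial>\<rho> \<partial>\<rho>)"
    by (rule action_distr_circle[OF prob_space_axioms Tm TS])
  also have "\<dots> = (\<Sum>p\<in>?P. prob {p} * (\<integral>y. L_fun \<tau> (?T p) (?T y) \<partial>\<rho>))"
    by (rule integral_finite_support[OF fin]) measurable
  also have "\<dots> = (\<Sum>p\<in>?P. prob {p} * (\<Sum>q\<in>?P. prob {q} * L_fun \<tau> (?T p) (?T q)))"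
    by (intro sum.cong refl arg_cong2[where f = "(*)"] integral_finite_support[OF fin]) measurable
  finally show ?thesis by (simp add: sum_distrib_left mult.assoc)
qed

lemma action_finite_support:
  assumes fin: "finite (measure_support \<rho>)"
  shows "action \<tau> \<rho> = (\<Sum>p\<in>measure_support \<rho>. \<Sum>q\<in>measure_support \<rho>.
    prob {p} * prob {q} * L_fun \<tau> p q)"
proof -
  have "action \<tau> \<rho> = (\<Sum>p\<in>measure_support \<rho>. prob {p} * potential \<tau> p)"
    unfolding action_potential by (rule integral_finite_support[OF fin]) measurable
  then show ?thesis by (simp add: potential_finite[OF fin] sum_distrib_left mult.assoc)
qed

end

context large_tau
begin

lemma cos_eq_theta_cases:
  assumes "cos u = cos \<theta>" "0 < u" "u < 2 * pi" shows "u = \<theta> \<or> u = 2 * pi - \<theta>"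
proof (cases "u \<le> pi")
  case True
  then show ?thesis using cos_inj_pi[of u \<theta>] assms theta_bounds by simp
next
  case False
  have "cos (2 * pi - u) = cos \<theta>" using assms(1) by (simp add: cos_diff)
  then show ?thesis using cos_inj_pi[of "2 * pi - u" \<theta>] False assms theta_bounds by simp
qed

end

context large_minimizer
begin

text \<open>Two gaps shorter than \<open>\<theta>\<close> cut the support into two arcs. Only the two pairs facing each other
  across these gaps interact, so by strict concavity moving one arc rigidly, either forwards or
  backwards, decreases the action.\<close>

lemma no_two_short_gaps:
  assumes T: "x \<in> \<Theta>" "a \<in> \<Theta>" "y \<in> \<Theta>" "b \<in> \<Theta>"
    and ord: "x < a" "a \<le> y" "y < b" "b \<le> x + 2 * pi"
    and short: "a < x + \<theta>" "b < y + \<theta>"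
    and gap: "\<And>r. x < r \<Longrightarrow> r < a \<Longrightarrow> r \<notin> \<Theta>" "\<And>r. y < r \<Longrightarrow> r < b \<Longrightarrow> r \<notin> \<Theta>"
  shows False
proof -
  let ?P = "measure_support \<rho>"
  define A where "A = circ ` (\<Theta> \<inter> {a..y})"
  have A: "A \<subseteq> ?P" by (auto simp: A_def \<Theta>_def)
  \<comment> \<open>Lifted into the period that starts at a, a support point outside the arc is
    confined to [b, x + 2 pi] by the two gaps.\<close>
  have outside: "\<exists>r\<in>\<Theta>. q = circ r \<and> b \<le> r \<and> r \<le> x + 2 * pi" if q: "q \<in> ?P - A" for q
  proof -
    have "q \<in> ?P" using q by simp
    then obtain r0 where r0: "q = circ r0" "r0 \<in> \<Theta>" by (rule support_Theta)
    obtain k :: int where k: "a \<le> r0 + 2 * pi * of_int k" "r0 + 2 * pi * of_int k < a + 2 * pi"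
      by (rule shift_into_period)
    define r where "r = r0 + 2 * pi * of_int k"
    have r: "a \<le> r" "r < a + 2 * pi" "q = circ r" "r \<in> \<Theta>"
      using k r0 Theta_shift[OF r0(2), of k] by (simp_all add: r_def)
    have "\<not> r \<le> y" using q r by (auto simp: A_def)
    then have "b \<le> r" using gap(2)[of r] r(4) by linarith
    moreover have "r - 2 * pi \<le> x" by (rule leI) (use gap(1)[of "r - 2 * pi"] r in auto)
    ultimately show ?thesis using r by (intro bexI[of _ r]) auto
  qed
  \<comment> \<open>A pair across at distance exactly \<theta> encloses y or b, or on the other side
    x or a, strictly, because both gaps are shorter than \<theta>. This contradicts
    \<open>Theta_gap\<close>, so no such pair sits at the kink.\<close>
  have ne: "p \<bullet> q \<noteq> cos \<theta>" if p: "p \<in> A" and q: "q \<in> ?P - A" for p q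
  proof
    assume eq: "p \<bullet> q = cos \<theta>"
    obtain s where s: "p = circ s" "s \<in> \<Theta>" "a \<le> s" "s \<le> y" using p by (auto simp: A_def)
    obtain r where r: "q = circ r" "r \<in> \<Theta>" "b \<le> r" "r \<le> x + 2 * pi" using outside[OF q] by blast
    have "cos (r - s) = cos \<theta>"
      using eq by (simp add: s r circ_inner) (metis cos_minus minus_diff_eq)
    then have "r - s = \<theta> \<or> r - s = 2 * pi - \<theta>"
      using s r ord by (intro cos_eq_theta_cases) auto
    then show False
    proof
      assume "r - s = \<theta>"
      then have rs: "r = s + \<theta>" by simp
      have "s < y" if "s \<noteq> y" using that s by simp
      moreover have "b < r" if "r \<noteq> b" using that r by simp
      ultimately show False
        using Theta_gap[of s y] Theta_gap[of s b] s r T ord short unfolding rs by (cases "s = y") force+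
    next
      assume "r - s = 2 * pi - \<theta>"
      then have rs: "s = (r - 2 * pi) + \<theta>" by simp
      have r': "r - 2 * pi \<in> \<Theta>" "r - 2 * pi + \<theta> \<in> \<Theta>" using r s(2) rs by simp_all
      show False
        using Theta_gap[OF r', of x] Theta_gap[OF r', of a] s r T ord short unfolding rs
        by (cases "r - 2 * pi = x") force+
    qed
  qed
  \<comment> \<open>Small enough for \<open>K_second_difference\<close> to apply to all pairs across
    at once.\<close>
  obtain h where h: "0 < h" "h \<le> 1"
    and hd: "\<And>p. p \<in> A \<times> (?P - A) \<Longrightarrow> h \<le> (case p of (p, q) \<Rightarrow> \<bar>p \<bullet> q - cos \<theta>\<bar>)"
  proof (rule finite_pos_lower_bound[of "A \<times> (?P - A)" "\<lambda>(p, q). \<bar>p \<bullet> q - cos \<theta>\<bar>"])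
    show "finite (A \<times> (?P - A))"
      using finite_support finite_subset[OF A finite_support] by simp
    show "0 < (case p of (p, q) \<Rightarrow> \<bar>p \<bullet> q - cos \<theta>\<bar>)" if "p \<in> A \<times> (?P - A)" for p
      using that ne by auto
  qed blast
  let ?T = "shift_on A h" and ?T' = "shift_on A (- h)"
  \<comment> \<open>The sum over both directions of motion, to be compared with twice the kernel: if
    the two actions together stay below 2 S, one of them is below S, whichever it is.\<close>
  define d where "d p q = L_fun \<tau> (?T p) (?T q) + L_fun \<tau> (?T' p) (?T' q)" for p q
  have d_commute: "d p q = d q p" for p q by (simp add: d_def L_fun_commute)
  have mixed: "d p q \<le> 2 * L_fun \<tau> p q" "cos \<theta> < p \<bullet> q \<Longrightarrow> d p q < 2 * L_fun \<tau> p q"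
    if p: "p \<in> A" and q: "q \<in> ?P - A" for p q
  proof -
    obtain s where s: "p = circ s" using p by (auto simp: A_def)
    obtain r where r: "q = circ r" using outside[OF q] by blast
    have "h \<le> \<bar>cos (s - r) - cos \<theta>\<bar>" using hd[of "(p, q)"] p q by (simp add: s r circ_inner)
    moreover have "d p q = K (s - r + h) + K (s - r - h)"
      using p q by (simp add: d_def shift_on_def s r rot_circ L_fun_circ algebra_simps)
    ultimately show "d p q \<le> 2 * L_fun \<tau> p q" "cos \<theta> < p \<bullet> q \<Longrightarrow> d p q < 2 * L_fun \<tau> p q"
      using K_second_difference[OF h, of "s - r"] by (auto simp: s r L_fun_circ circ_inner)
  qed
  have PS: "p \<in> S1" if "p \<in> ?P" for p using that support_subset by (rule rev_subsetD)
  have d_le: "d p q \<le> 2 * L_fun \<tau> p q" if p: "p \<in> ?P" and q: "q \<in> ?P" for p q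
  proof (cases "p \<in> A"; cases "q \<in> A")
    assume "p \<in> A" "q \<in> A"
    then have "d p q = 2 * L_fun \<tau> p q" using PS[OF p] PS[OF q] by (simp add: d_def shift_on_def L_fun_rot)
    then show ?thesis by simp
  next
    assume "p \<notin> A" "q \<notin> A"
    then show ?thesis by (simp add: d_def shift_on_def)
  next
    assume "p \<in> A" "q \<notin> A"
    then show ?thesis using mixed(1)[of p q] q by simp
  next
    assume "p \<notin> A" "q \<in> A"
    then have "d q p \<le> 2 * L_fun \<tau> q p" using mixed(1)[of q p] p by simp
    then show ?thesis by (simp add: d_commute[of p] L_fun_commute[of \<tau> p])
  qed
  have yA: "circ y \<in> A" using T ord by (auto simp: A_def)
  have bA: "circ b \<in> ?P - A"
  proof -
    have "circ b \<notin> A"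
    proof
      assume "circ b \<in> A"
      then obtain s where s: "circ b = circ s" "s \<in> \<Theta> \<inter> {a..y}" unfolding A_def by (rule imageE)
      have "b = s" by (rule circ_inj_period[OF s(1)]) (use s(2) ord in auto)
      then show False using s(2) ord by simp
    qed
    then show ?thesis using T(4) by (simp add: \<Theta>_def)
  qed
  \<comment> \<open>The pair facing each other across the gap from y to b is within range of the
    kernel. This one strict inequality suffices, since all masses are positive.\<close>
  have "cos \<theta> < cos (b - y)"
    using ord short theta_bounds by (intro cos_monotone_0_pi) auto
  then have "cos \<theta> < circ y \<bullet> circ b" by (simp add: circ_inner) (metis cos_minus minus_diff_eq)
  then have strict: "d (circ y) (circ b) < 2 * L_fun \<tau> (circ y) (circ b)"
    by (rule mixed(2)[OF yA bA])
  define w where "w p = prob {p}" for p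
  have w: "0 < w p" if "p \<in> ?P" for p unfolding w_def by (rule prob_singleton_pos[OF finite_support that])
  have "2 * S \<le> (\<Sum>p\<in>?P. \<Sum>q\<in>?P. w p * w q * d p q)"
    using action_shift_on[OF finite_support A, of \<tau> h] action_shift_on[OF finite_support A, of \<tau> "- h"]
    by (simp add: d_def w_def distrib_left sum.distrib)
  also have "\<dots> < (\<Sum>p\<in>?P. \<Sum>q\<in>?P. w p * w q * (2 * L_fun \<tau> p q))"
  proof (rule sum_strict_mono_ex1)
    have term_le: "w p * w q * d p q \<le> w p * w q * (2 * L_fun \<tau> p q)" if "p \<in> ?P" "q \<in> ?P" for p q
      using d_le[OF that] w[OF that(1)] w[OF that(2)] by (intro mult_left_mono) auto
    then show "\<forall>p\<in>?P. (\<Sum>q\<in>?P. w p * w q * d p q) \<le> (\<Sum>q\<in>?P. w p * w q * (2 * L_fun \<tau> p q))"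
      by (intro ballI sum_mono)
    have yP: "circ y \<in> ?P" and bP: "circ b \<in> ?P" using yA A bA by auto
    have "(\<Sum>q\<in>?P. w (circ y) * w q * d (circ y) q) < (\<Sum>q\<in>?P. w (circ y) * w q * (2 * L_fun \<tau> (circ y) q))"
    proof (rule sum_strict_mono_ex1[OF finite_support])
      show "\<forall>q\<in>?P. w (circ y) * w q * d (circ y) q \<le> w (circ y) * w q * (2 * L_fun \<tau> (circ y) q)"
        using term_le[OF yP] by blast
      have "w (circ y) * w (circ b) * d (circ y) (circ b) < w (circ y) * w (circ b) * (2 * L_fun \<tau> (circ y) (circ b))"
        using strict w[OF yP] w[OF bP] by (intro mult_strict_left_mono) auto
      then show "\<exists>q\<in>?P. w (circ y) * w q * d (circ y) q < w (circ y) * w q * (2 * L_fun \<tau> (circ y) q)"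
        using bP by blast
    qed
    then show "\<exists>p\<in>?P. (\<Sum>q\<in>?P. w p * w q * d p q) < (\<Sum>q\<in>?P. w p * w q * (2 * L_fun \<tau> p q))"
      using yP by blast
  qed (rule finite_support)
  also have "\<dots> = 2 * S"
    using action_finite_support[OF finite_support, of \<tau>]
    by (simp add: minimal w_def sum_distrib_left mult_ac)
  finally show False by simp
qed

lemma support_chain:
  obtains a n g where "0 < g" "g \<le> \<theta>" "real n * \<theta> + g = 2 * pi"
    and "measure_support \<rho> = (\<lambda>j. circ (a + real j * \<theta>)) ` {..n}"
proof -
  define is_next where "is_next s r \<longleftrightarrow> r \<in> \<Theta> \<and> s < r \<and> r \<le> s + \<theta> \<and> (\<forall>q. s < q \<longrightarrow> q < r \<longrightarrow> q \<notin> \<Theta>)" for s r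
  have ex_next: "\<exists>r. is_next s r" if "s \<in> \<Theta>" for s
    unfolding is_next_def using Theta_next[OF that] by metis
  obtain p where "p \<in> measure_support \<rho>" using support_nonempty by blast
  then obtain s0 where s0: "s0 \<in> \<Theta>" by (rule support_Theta)
  \<comment> \<open>The starting gap is a short one if there is any, and arbitrary otherwise. By
    \<open>no_two_short_gaps\<close> every gap between a and x + 2 pi then equals \<theta>, and the
    gap from x to a, possibly also \<theta>, closes the circle.\<close>
  have "\<exists>x a. x \<in> \<Theta> \<and> is_next x a \<and> ((\<exists>y b. y \<in> \<Theta> \<and> is_next y b \<and> b < y + \<theta>) \<longrightarrow> a < x + \<theta>)"
    using s0 ex_next by metis
  then obtain x a where x: "x \<in> \<Theta>" and xa: "is_next x a"
    and choice: "\<And>y b. y \<in> \<Theta> \<Longrightarrow> is_next y b \<Longrightarrow> b < y + \<theta> \<Longrightarrow> a < x + \<theta>" by blast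
  have a: "a \<in> \<Theta>" "x < a" "a \<le> x + \<theta>" "\<And>q. x < q \<Longrightarrow> q < a \<Longrightarrow> q \<notin> \<Theta>"
    using xa by (auto simp: is_next_def)
  have x2: "x + 2 * pi \<in> \<Theta>" using x by simp
  have step: "s + \<theta> \<in> \<Theta> \<and> s + \<theta> \<le> x + 2 * pi \<and> (\<forall>q. s < q \<longrightarrow> q < s + \<theta> \<longrightarrow> q \<notin> \<Theta>)"
    if s: "s \<in> \<Theta>" "a \<le> s" "s < x + 2 * pi" for s
  proof -
    obtain r where r: "is_next s r" using ex_next[OF s(1)] by blast
    then have r': "r \<in> \<Theta>" "s < r" "r \<le> s + \<theta>" "\<And>q. s < q \<Longrightarrow> q < r \<Longrightarrow> q \<notin> \<Theta>"
      by (auto simp: is_next_def)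
    have rx: "r \<le> x + 2 * pi" using r'(4)[OF s(3)] x2 by linarith
    have "\<not> r < s + \<theta>"
    proof
      assume short: "r < s + \<theta>"
      from choice[OF s(1) r short] have "a < x + \<theta>" .
      from no_two_short_gaps[OF x a(1) s(1) r'(1) a(2) s(2) r'(2) rx this short a(4) r'(4)]
      show False by simp
    qed
    then have "r = s + \<theta>" using r'(3) by simp
    then show ?thesis using r' rx by blast
  qed
  have chain: "real i * \<theta> \<le> x + 2 * pi - a \<Longrightarrow> a + real i * \<theta> \<in> \<Theta> \<and>
      (\<forall>r\<in>\<Theta>. a \<le> r \<longrightarrow> r \<le> a + real i * \<theta> \<longrightarrow> (\<exists>j\<le>i. r = a + real j * \<theta>))" for i
  proof (induction i)
    case 0
    then show ?case using a by auto
  next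
    case (Suc i)
    let ?s = "a + real i * \<theta>"
    have ss: "a + real (Suc i) * \<theta> = ?s + \<theta>" by (simp add: algebra_simps)
    have lt: "?s + \<theta> \<le> x + 2 * pi" using Suc.prems ss by linarith
    have i0: "0 \<le> real i * \<theta>" using theta_bounds by simp
    have IH: "?s \<in> \<Theta>" "\<And>r. r \<in> \<Theta> \<Longrightarrow> a \<le> r \<Longrightarrow> r \<le> ?s \<Longrightarrow> \<exists>j\<le>i. r = a + real j * \<theta>"
      using Suc.IH lt theta_bounds by auto
    have st: "?s + \<theta> \<in> \<Theta>" "\<And>q. ?s < q \<Longrightarrow> q < ?s + \<theta> \<Longrightarrow> q \<notin> \<Theta>"
      using step[OF IH(1)] i0 lt theta_bounds by auto
    have "\<exists>j\<le>Suc i. r = a + real j * \<theta>" if r: "r \<in> \<Theta>" "a \<le> r" "r \<le> ?s + \<theta>" for r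
    proof (cases "r \<le> ?s")
      case True
      then show ?thesis using IH(2)[OF r(1,2)] le_SucI by blast
    next
      case False
      then have "r = ?s + \<theta>" using st(2)[of r] r by linarith
      then show ?thesis using ss by (intro exI[of _ "Suc i"]) simp
    qed
    then show ?case using st(1) unfolding ss by blast
  qed
  define n where "n = nat \<lfloor>(x + 2 * pi - a) / \<theta>\<rfloor>"
  have pos: "0 \<le> x + 2 * pi - a" using a theta_bounds pi_gt_zero by linarith
  then have "real n = of_int \<lfloor>(x + 2 * pi - a) / \<theta>\<rfloor>" using theta_bounds by (simp add: n_def)
  then have "real n \<le> (x + 2 * pi - a) / \<theta>" "(x + 2 * pi - a) / \<theta> < real n + 1" by linarith+
  then have n: "real n * \<theta> \<le> x + 2 * pi - a" "x + 2 * pi - a < real n * \<theta> + \<theta>"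
    using theta_bounds by (auto simp: field_simps)
  have n0: "0 \<le> real n * \<theta>" using theta_bounds by simp
  \<comment> \<open>\<open>step\<close> would supply one more full step before x + 2 pi, while n is
    already the largest number that fits.\<close>
  have end_eq: "a + real n * \<theta> = x + 2 * pi"
  proof (rule ccontr)
    assume "a + real n * \<theta> \<noteq> x + 2 * pi"
    then have lt: "a + real n * \<theta> < x + 2 * pi" using n by linarith
    have "a + real n * \<theta> + \<theta> \<le> x + 2 * pi" using step[of "a + real n * \<theta>"] chain[OF n(1)] lt n0 by auto
    then show False using n by linarith
  qed
  have "measure_support \<rho> = (\<lambda>j. circ (a + real j * \<theta>)) ` {..n}"
  proof (intro equalityI subsetI)
    fix p assume "p \<in> measure_support \<rho>"
    then obtain s where s: "p = circ s" "s \<in> \<Theta>" by (rule support_Theta)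
    obtain k :: int where k: "a \<le> s + 2 * pi * of_int k" "s + 2 * pi * of_int k < a + 2 * pi"
      by (rule shift_into_period)
    define r where "r = s + 2 * pi * of_int k"
    have r: "a \<le> r" "r < a + 2 * pi" "p = circ r" "r \<in> \<Theta>"
      using k s Theta_shift[OF s(2), of k] by (simp_all add: r_def)
    have "r - 2 * pi \<le> x" by (rule leI) (use a(4)[of "r - 2 * pi"] r in auto)
    then have "r \<le> a + real n * \<theta>" using end_eq by linarith
    then obtain j where "j \<le> n" "r = a + real j * \<theta>" using chain[OF n(1)] r by blast
    then show "p \<in> (\<lambda>j. circ (a + real j * \<theta>)) ` {..n}" using r(3) by blast
  next
    fix p assume "p \<in> (\<lambda>j. circ (a + real j * \<theta>)) ` {..n}"
    then obtain j where j: "j \<le> n" "p = circ (a + real j * \<theta>)" by blast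
    have "real j * \<theta> \<le> real n * \<theta>" using j(1) theta_bounds by (intro mult_right_mono) auto
    then have "a + real j * \<theta> \<in> \<Theta>" using chain[of j] n by linarith
    then show "p \<in> measure_support \<rho>" by (simp add: j(2) \<Theta>_def)
  qed
  moreover have "0 < a - x" "a - x \<le> \<theta>" "real n * \<theta> + (a - x) = 2 * pi" using a end_eq by auto
  ultimately show ?thesis by (intro that[of "a - x" n a])
qed

end

section \<open>The minimizing chain\<close>

context large_tau
begin

text \<open>n \<theta> < 2 pi \<le> (n + 1) \<theta>; the closing gap equals \<theta> exactly when
  \<theta> divides 2 pi.\<close>

lemma m0_eq:
  assumes "0 < g" "g \<le> \<theta>" "real n * \<theta> + g = 2 * pi" shows "m0 \<tau> = Suc n"
  unfolding m0_def
proof (rule Least_equality)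
  have "2 * pi \<le> real (Suc n) * \<theta>" using assms by (simp add: algebra_simps)
  then show "2 * pi / \<theta> \<le> real (Suc n)" using theta_bounds by (simp add: pos_divide_le_eq)
next
  fix k assume "2 * pi / \<theta> \<le> real k"
  then have "2 * pi \<le> real k * \<theta>" using theta_bounds by (simp add: pos_divide_le_eq)
  then have "real n * \<theta> < real k * \<theta>" using assms by linarith
  then show "Suc n \<le> k" using theta_bounds by simp
qed

text \<open>The n and g of \<open>support_chain\<close>, expressed by \<tau> alone, so that all
  minimizers share them. The chain is indexed from 0, whence the subtraction of 1.\<close>

definition last_index :: nat where "last_index = m0 \<tau> - 1"
definition closing_gap :: real where "closing_gap = 2 * pi - real last_index * \<theta>"

lemma cos_le_theta:
  assumes "\<theta> \<le> u" "u \<le> 2 * pi - \<theta>" shows "cos u \<le> cos \<theta>"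
proof (cases "u \<le> pi")
  case True
  then show ?thesis using assms theta_bounds by (intro cos_monotone_0_pi_le) auto
next
  case False
  have "cos u = cos (2 * pi - u)" by (simp add: cos_diff)
  also have "\<dots> \<le> cos \<theta>" using False assms theta_bounds by (intro cos_monotone_0_pi_le) auto
  finally show ?thesis .
qed

end

context large_minimizer
begin

lemma chain_numbers:
  "0 < closing_gap" "closing_gap \<le> \<theta>" "real last_index * \<theta> + closing_gap = 2 * pi"
  "m0 \<tau> = Suc last_index" "2 \<le> last_index"
proof -
  obtain a n g where g: "0 < g" "g \<le> \<theta>" "real n * \<theta> + g = 2 * pi" by (rule support_chain)
  from m0_eq[OF g] have n: "last_index = n" by (simp add: last_index_def)
  then have gap: "closing_gap = g" using g by (simp add: closing_gap_def)
  show "0 < closing_gap" "closing_gap \<le> \<theta>" "real last_index * \<theta> + closing_gap = 2 * pi"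
    "m0 \<tau> = Suc last_index"
    using g m0_eq[OF g] by (simp_all add: gap n)
  show "2 \<le> last_index"
  proof (rule ccontr)
    assume "\<not> 2 \<le> last_index"
    then have "real n \<le> 1" using n by simp
    then have "real n * \<theta> \<le> 1 * \<theta>" using theta_bounds by (intro mult_right_mono) auto
    then show False using g theta_bounds pi_gt_zero by linarith
  qed
qed

lemma K_closing_gap: "K (real last_index * \<theta>) = K closing_gap"
proof -
  have "real last_index * \<theta> = 2 * pi - closing_gap" using chain_numbers(3) by simp
  then show ?thesis by (intro L_angle_cong) (simp add: cos_diff)
qed

lemma K_closing_gap_less: "K closing_gap < K 0"
proof (rule K_less)
  show "cos closing_gap < 1"
    using chain_numbers(1,2) theta_bounds cos_monotone_0_pi[of 0 closing_gap] by simp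
qed

text \<open>One way round, the points are at least one step apart; the other way, they are separated
  by the closing gap and at least one step.\<close>

lemma cos_chain_le:
  assumes "0 < d" "d < last_index" shows "cos (real d * \<theta>) \<le> cos \<theta>"
proof (rule cos_le_theta)
  show "\<theta> \<le> real d * \<theta>" using mult_right_mono[of 1 "real d" \<theta>] assms theta_bounds by simp
  have "real d + 1 \<le> real last_index" using assms by simp
  then have "(real d + 1) * \<theta> \<le> real last_index * \<theta>"
    using theta_bounds by (intro mult_right_mono) auto
  then have "real d * \<theta> + \<theta> \<le> real last_index * \<theta>" by (simp add: distrib_right)
  then show "real d * \<theta> \<le> 2 * pi - \<theta>" using chain_numbers(1,3) by linarith
qed

text \<open>Consecutive points sit exactly where the kernel vanishes, so the Gram matrix is diagonal
  except for the two corner entries that belong to the ends of the chain.\<close>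

lemma K_chain:
  assumes "i \<le> last_index" "j \<le> last_index"
  shows "K ((real i - real j) * \<theta>) =
    (if i = j then K 0 else if {i, j} = {0, last_index} then K closing_gap else 0)"
proof -
  have less: "K ((real j - real i) * \<theta>) = (if i = 0 \<and> j = last_index then K closing_gap else 0)"
    if "i < j" "j \<le> last_index" for i j
  proof (cases "i = 0 \<and> j = last_index")
    case True
    then show ?thesis using K_closing_gap by simp
  next
    case False
    then have "j - i < last_index" "0 < j - i" using that by linarith+
    then have "cos (real (j - i) * \<theta>) \<le> cos \<theta>" by (intro cos_chain_le)
    then have "K (real (j - i) * \<theta>) = 0" unfolding K_eq_0_iff .
    then have "K ((real j - real i) * \<theta>) = 0" using that by (simp add: of_nat_diff)
    then show ?thesis using False by presburger
  qed
  have sym: "K ((real i - real j) * \<theta>) = K ((real j - real i) * \<theta>)"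
    using L_angle_minus[of \<tau> "(real i - real j) * \<theta>"] by (simp add: algebra_simps)
  show ?thesis
    using less[of i j] less[of j i] assms sym chain_numbers(5)
    by (cases i j rule: linorder_cases) (auto simp: doubleton_eq_iff)
qed

lemma inj_on_chain: "inj_on (\<lambda>j. circ (a + real j * \<theta>)) {..last_index}"
proof (rule inj_onI)
  fix i j assume ij: "i \<in> {..last_index}" "j \<in> {..last_index}"
    and eq: "circ (a + real i * \<theta>) = circ (a + real j * \<theta>)"
  have "\<bar>real i - real j\<bar> \<le> real last_index" using ij by auto
  then have "\<bar>(real i - real j) * \<theta>\<bar> \<le> real last_index * \<theta>"
    unfolding abs_mult using theta_bounds by (intro mult_mono) auto
  then have "\<bar>(a + real i * \<theta>) - (a + real j * \<theta>)\<bar> < 2 * pi"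
    using chain_numbers(1,3) by (simp add: left_diff_distrib)
  with eq have "a + real i * \<theta> = a + real j * \<theta>" by (rule circ_inj_period)
  then show "i = j" using theta_bounds by simp
qed

text \<open>The solution of the linear system saying that the potential equals S at every point of
  the chain. It depends on \<tau> only.\<close>

definition weight :: "nat \<Rightarrow> real" where
  "weight j = (if j = 0 \<or> j = last_index then S / (K 0 + K closing_gap) else S / K 0)"

text \<open>Stated through integrals so that f = 1 yields the equation for S and indicators yield
  uniqueness; the starting angle a is all that can vary between minimizers.\<close>

lemma chain_weights:
  obtains a where "measure_support \<rho> = (\<lambda>j. circ (a + real j * \<theta>)) ` {..last_index}"
    and "\<forall>f \<in> borel_measurable \<rho>.
      (\<integral>x. f x \<partial>\<rho>) = (\<Sum>j\<le>last_index. weight j * f (circ (a + real j * \<theta>)))"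
proof -
  obtain a n g where g: "0 < g" "g \<le> \<theta>" "real n * \<theta> + g = 2 * pi"
    and supp: "measure_support \<rho> = (\<lambda>j. circ (a + real j * \<theta>)) ` {..n}"
    by (rule support_chain)
  from m0_eq[OF g] have n: "n = last_index" by (simp add: last_index_def)
  define x where "x j = circ (a + real j * \<theta>)" for j :: nat
  have P: "measure_support \<rho> = x ` {..last_index}" by (simp add: supp n x_def)
  define w where "w j = prob {x j}" for j
  have int: "(\<integral>y. f y \<partial>\<rho>) = (\<Sum>j\<le>last_index. w j * f (x j))"
    if "f \<in> borel_measurable \<rho>" for f :: "plane \<Rightarrow> real"
    using integral_finite_support[OF finite_support that] inj_on_chain[of a]
    unfolding P by (simp add: sum.reindex w_def x_def[abs_def])
  have Lx: "L_fun \<tau> (x i) (x j) = K ((real i - real j) * \<theta>)" for i j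
    by (simp add: x_def L_fun_circ algebra_simps)
  let ?N = "last_index"
  have N: "?N \<noteq> 0" using chain_numbers(5) by simp
  have bal: "(\<Sum>j\<le>?N. w j * (if i = j then K 0 else if {i, j} = {0, ?N} then K closing_gap else 0)) = S"
    if i: "i \<le> ?N" for i
  proof -
    have "\<phi> (x i) = S" using i by (intro potential_eq) (simp add: P)
    moreover have "\<phi> (x i) = (\<Sum>j\<le>?N. w j * L_fun \<tau> (x i) (x j))"
      unfolding potential_def by (rule int) measurable
    moreover have "\<dots> = (\<Sum>j\<le>?N. w j * (if i = j then K 0 else if {i, j} = {0, ?N} then K closing_gap else 0))"
      by (intro sum.cong refl arg_cong2[where f = "(*)"]) (use K_chain[OF i] Lx in auto)
    ultimately show ?thesis by simp
  qed
  have mid: "w i * K 0 = S" if i: "0 < i" "i < ?N" for i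
  proof -
    have "(\<Sum>j\<le>?N. w j * (if i = j then K 0 else if {i, j} = {0, ?N} then K closing_gap else 0))
        = (\<Sum>j\<le>?N. if j = i then w j * K 0 else 0)"
      by (intro sum.cong refl) (use i in \<open>auto simp: doubleton_eq_iff\<close>)
    then show ?thesis using bal[of i] i by simp
  qed
  have ends: "w i * K 0 + w j * K closing_gap = S" if ij: "{i, j} = {0, ?N}" for i j
  proof -
    have ij': "i \<noteq> j" "i \<le> ?N" "j \<le> ?N" using ij N by (auto simp: doubleton_eq_iff)
    have "(\<Sum>k\<le>?N. w k * (if i = k then K 0 else if {i, k} = {0, ?N} then K closing_gap else 0))
        = (\<Sum>k\<le>?N. (if k = i then w k * K 0 else 0) + (if k = j then w k * K closing_gap else 0))"
      by (intro sum.cong refl) (use ij ij' in \<open>auto simp: doubleton_eq_iff\<close>)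
    also have "\<dots> = w i * K 0 + w j * K closing_gap"
      unfolding sum.distrib using ij' by simp
    finally show ?thesis using bal[OF ij'(2)] by simp
  qed
  have e1: "w 0 * K 0 + w ?N * K closing_gap = S" by (rule ends) simp
  have e2: "w ?N * K 0 + w 0 * K closing_gap = S" by (rule ends) auto
  \<comment> \<open>The difference of the two end equations; K closing_gap < K 0 then forces equal
    masses at both ends.\<close>
  have "(w 0 - w ?N) * (K 0 - K closing_gap) = 0"
    using e1 e2 by (simp add: algebra_simps)
  then have w0N: "w 0 = w ?N" using K_closing_gap_less by simp
  have pos: "0 < K 0 + K closing_gap" using K_0_pos by (intro add_pos_nonneg) simp_all
  have "w j = weight j" if "j \<le> ?N" for j
  proof -
    have "w 0 * (K 0 + K closing_gap) = S" using e1 w0N by (simp add: algebra_simps)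
    then have "w 0 = S / (K 0 + K closing_gap)" using pos by (simp add: eq_divide_eq)
    moreover have "w j = S / K 0" if "j \<noteq> 0" "j \<noteq> ?N"
      using mid[of j] that \<open>j \<le> ?N\<close> K_0_pos by (simp add: eq_divide_eq)
    ultimately show ?thesis using w0N by (auto simp: weight_def)
  qed
  then have "\<forall>f \<in> borel_measurable \<rho>. (\<integral>y. f y \<partial>\<rho>) = (\<Sum>j\<le>?N. weight j * f (x j))"
    using int by simp
  then show ?thesis using P unfolding x_def by (rule that[rotated])
qed

text \<open>Total mass one, read as an equation for S: two end weights and m0 - 2 inner
  ones.\<close>

lemma min_action_formula:
  "S = K 0 * (K 0 + K closing_gap) / ((real (m0 \<tau>) - 2) * (K 0 + K closing_gap) + 2 * K 0)"
proof -
  obtain a where "measure_support \<rho> = (\<lambda>j. circ (a + real j * \<theta>)) ` {..last_index}"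
    and int: "\<forall>f \<in> borel_measurable \<rho>.
      (\<integral>x. f x \<partial>\<rho>) = (\<Sum>j\<le>last_index. weight j * f (circ (a + real j * \<theta>)))"
    by (rule chain_weights)
  let ?N = "last_index"
  let ?A = "K 0 + K closing_gap"
  have "1 = (\<Sum>j\<le>?N. weight j)" using bspec[OF int, of "\<lambda>_. 1"] prob_space by simp
  also have "\<dots> = (\<Sum>j\<in>insert 0 (insert ?N {0<..<?N}). weight j)"
    using chain_numbers(5) by (intro sum.cong) auto
  also have "\<dots> = S / ?A + (S / ?A + (\<Sum>j\<in>{0<..<?N}. S / K 0))"
    using chain_numbers(5) by (simp add: weight_def)
  also have "\<dots> = 2 * (S / ?A) + (real ?N - 1) * (S / K 0)"
    using chain_numbers(5) by (simp add: of_nat_diff)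
  finally have one: "2 * (S / ?A) + (real ?N - 1) * (S / K 0) = 1" by simp
  have pos: "0 < ?A" using K_0_pos by (intro add_pos_nonneg) simp_all
  have "s * (m * A + 2 * k) = (2 * (s / A) + m * (s / k)) * (k * A)" if "0 < A" "0 < k"
    for s m A k :: real using that by (simp add: field_simps)
  from this[OF pos K_0_pos]
  have "S * ((real ?N - 1) * ?A + 2 * K 0) = (2 * (S / ?A) + (real ?N - 1) * (S / K 0)) * (K 0 * ?A)" .
  then have eq: "S * ((real ?N - 1) * ?A + 2 * K 0) = K 0 * ?A" by (simp only: one mult_1_left)
  have "0 \<le> (real ?N - 1) * ?A" using pos chain_numbers(5) by (intro mult_nonneg_nonneg) auto
  then have "0 < (real ?N - 1) * ?A + 2 * K 0" using K_0_pos by linarith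
  then have "S = K 0 * ?A / ((real ?N - 1) * ?A + 2 * K 0)" using eq by (simp add: eq_divide_eq)
  moreover have "real (m0 \<tau>) - 2 = real ?N - 1" by (simp add: chain_numbers(4))
  ultimately show ?thesis by simp
qed

text \<open>\<gamma> is \<open>closing_gap\<close>: along the chain the ends are 2 pi - closing_gap
  apart, and arccos returns the short way round.\<close>

lemma support_is_chain:
  "\<exists>xs \<gamma>. is_chain \<tau> xs \<and> length xs = m0 \<tau> \<and> measure_support \<rho> = set xs \<and>
    \<gamma> = arccos (hd xs \<bullet> last xs) \<and> \<gamma> \<in> {0<..\<theta>} \<and>
    S = K 0 * (K 0 + K \<gamma>) / ((real (m0 \<tau>) - 2) * (K 0 + K \<gamma>) + 2 * K 0)"
proof -
  obtain a where P: "measure_support \<rho> = (\<lambda>j. circ (a + real j * \<theta>)) ` {..last_index}"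
    by (rule chain_weights)
  define x where "x j = circ (a + real j * \<theta>)" for j :: nat
  define xs where "xs = map x [0..<m0 \<tau>]"
  have idx: "{0..<m0 \<tau>} = {..last_index}" by (auto simp: chain_numbers(4))
  have set: "set xs = measure_support \<rho>" by (simp add: xs_def P idx x_def)
  have "distinct xs"
    using inj_on_chain[of a] by (simp add: xs_def distinct_map idx x_def[abs_def])
  moreover have "xs ! i \<bullet> xs ! Suc i = cos \<theta>" if "Suc i < length xs" for i
    using that by (simp add: xs_def x_def circ_inner algebra_simps)
  moreover have "set xs \<subseteq> S1" using support_subset by (simp add: set)
  ultimately have "is_chain \<tau> xs" by (simp add: is_chain_def)
  moreover have "hd xs \<bullet> last xs = cos closing_gap"
  proof -
    have "hd xs = x 0" by (simp add: xs_def chain_numbers(4) upt_conv_Cons del: upt_Suc)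
    moreover have "last xs = x last_index" by (simp add: xs_def chain_numbers(4))
    ultimately have "hd xs \<bullet> last xs = cos (real last_index * \<theta>)"
      by (simp add: x_def circ_inner)
    also have "real last_index * \<theta> = 2 * pi - closing_gap" using chain_numbers(3) by simp
    finally show ?thesis by (simp add: cos_diff)
  qed
  then have "arccos (hd xs \<bullet> last xs) = closing_gap"
    using chain_numbers(1,2) theta_bounds by (simp add: arccos_cos)
  ultimately show ?thesis
    using min_action_formula chain_numbers(1,2) set by (intro exI[of _ xs] exI[of _ closing_gap]) (auto simp: xs_def)
qed

end

section \<open>Uniqueness up to rotation and conclusion\<close>

lemma large_minimizer_iff: "large_minimizer \<rho> \<tau> \<longleftrightarrow> minimizer \<tau> \<rho> \<and> \<tau> > sqrt (3 + sqrt 10)"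
  by (auto simp: large_minimizer_def circle_minimizer_def circle_minimizer_axioms_def large_tau_def
      minimizer_def circle_measure_iff)

text \<open>By \<open>chain_weights\<close> both measures have the same masses and the same steps,
  so the rotation by the difference of the starting angles carries one to the other.\<close>

lemma minimizer_unique:
  assumes "large_minimizer \<rho> \<tau>" "large_minimizer \<rho>' \<tau>"
  shows "\<exists>R. rotation_matrix R \<and> \<rho>' = rotate_measure R \<rho>"
proof -
  interpret A: large_minimizer \<rho> \<tau> by fact
  interpret B: large_minimizer \<rho>' \<tau> by fact
  obtain a where "measure_support \<rho> = (\<lambda>j. circ (a + real j * A.\<theta>)) ` {..A.last_index}"
    and a: "\<forall>f \<in> borel_measurable \<rho>.
      (\<integral>x. f x \<partial>\<rho>) = (\<Sum>j\<le>A.last_index. A.weight j * f (circ (a + real j * A.\<theta>)))"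
    by (rule A.chain_weights)
  obtain b where "measure_support \<rho>' = (\<lambda>j. circ (b + real j * A.\<theta>)) ` {..A.last_index}"
    and b: "\<forall>f \<in> borel_measurable \<rho>'.
      (\<integral>x. f x \<partial>\<rho>') = (\<Sum>j\<le>A.last_index. A.weight j * f (circ (b + real j * A.\<theta>)))"
    by (rule B.chain_weights)
  let ?R = "rot (b - a)"
  have Rm: "(\<lambda>x. ?R *v x) \<in> borel_measurable \<rho>"
    by (rule measurable_compose[OF A.measurable_ident_rho measurable_rot])
  have RS: "x \<in> space \<rho> \<Longrightarrow> ?R *v x \<in> S1" for x using rot_in_S1[of x] by simp
  interpret C: circle_measure "rotate_measure ?R \<rho>"
    unfolding rotate_measure_def by (rule circle_measure_distr(1)[OF A.prob_space_axioms Rm RS])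
  have "\<rho>' = rotate_measure ?R \<rho>"
  proof (rule measure_eqI)
    show "sets \<rho>' = sets (rotate_measure ?R \<rho>)" by (simp add: B.sets_rho C.sets_rho)
    fix E assume E: "E \<in> sets \<rho>'"
    then have E': "E \<in> sets (rotate_measure ?R \<rho>)" "E \<in> sets (restrict_space borel S1)" "E \<subseteq> S1"
      using B.in_sets by (simp_all add: B.sets_rho C.sets_rho)
    have "C.prob E = (\<integral>x. indicator E x \<partial>rotate_measure ?R \<rho>)"
      using E' by (simp add: Int_absorb2)
    also have "\<dots> = (\<integral>x. indicator E (?R *v x) \<partial>\<rho>)"
      unfolding rotate_measure_def using E'
      by (intro integral_distr_circle[OF A.prob_space_axioms Rm RS]) auto
    also have "\<dots> = (\<Sum>j\<le>A.last_index. A.weight j * indicator E (?R *v circ (a + real j * A.\<theta>)))"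
    proof (rule bspec[OF a])
      show "(\<lambda>x. indicator E (?R *v x) :: real) \<in> borel_measurable \<rho>"
        using E' by (intro measurable_compose[OF circle_measure_distr(2)[OF A.prob_space_axioms Rm RS]]) auto
    qed
    also have "\<dots> = (\<Sum>j\<le>A.last_index. A.weight j * indicator E (circ (b + real j * A.\<theta>)))"
      by (simp add: rot_circ algebra_simps)
    also have "\<dots> = (\<integral>x. indicator E x \<partial>\<rho>')"
      by (rule bspec[OF b, symmetric]) (use E in auto)
    also have "\<dots> = B.prob E" using E E'(3) by (simp add: Int_absorb2)
    finally show "emeasure \<rho>' E = emeasure (rotate_measure ?R \<rho>) E"
      by (simp add: B.emeasure_eq_measure C.emeasure_eq_measure)
  qed
  then show ?thesis using rotation_matrix_rot by blast
qed

text \<open>The existence clause keeps the other two from holding vacuously.\<close>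

theorem theorem4p4:
  fixes \<tau> :: real
  assumes "\<tau> > sqrt (3 + sqrt 10)"
  shows "(\<exists>\<rho>. minimizer \<tau> \<rho>) \<and>
    (\<forall>\<rho>. minimizer \<tau> \<rho> \<longrightarrow>
      (\<exists>xs \<gamma>. is_chain \<tau> xs \<and> length xs = m0 \<tau> \<and> measure_support \<rho> = set xs \<and>
        \<gamma> = arccos (hd xs \<bullet> last xs) \<and> \<gamma> \<in> {0<..theta_max \<tau>} \<and>
        min_action \<tau> =
          L_angle \<tau> 0 * (L_angle \<tau> 0 + L_angle \<tau> \<gamma>) /
          ((real (m0 \<tau>) - 2) * (L_angle \<tau> 0 + L_angle \<tau> \<gamma>) + 2 * L_angle \<tau> 0))) \<and>
    (\<forall>\<rho> \<rho>'. minimizer \<tau> \<rho> \<and> minimizer \<tau> \<rho>' \<longrightarrow>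
      (\<exists>R. rotation_matrix R \<and> \<rho>' = rotate_measure R \<rho>))"
proof -
  have lm: "large_minimizer \<rho> \<tau>" if "minimizer \<tau> \<rho>" for \<rho>
    using that assms by (simp add: large_minimizer_iff)
  show ?thesis
  proof (intro conjI allI impI)
    fix \<rho> assume "minimizer \<tau> \<rho>"
    from large_minimizer.support_is_chain[OF lm[OF this]]
    show "\<exists>xs \<gamma>. is_chain \<tau> xs \<and> length xs = m0 \<tau> \<and> measure_support \<rho> = set xs \<and>
        \<gamma> = arccos (hd xs \<bullet> last xs) \<and> \<gamma> \<in> {0<..theta_max \<tau>} \<and>
        min_action \<tau> =
          L_angle \<tau> 0 * (L_angle \<tau> 0 + L_angle \<tau> \<gamma>) /
          ((real (m0 \<tau>) - 2) * (L_angle \<tau> 0 + L_angle \<tau> \<gamma>) + 2 * L_angle \<tau> 0)" .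
  qed (auto intro: minimizer_exists minimizer_unique lm)
qed

end
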